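(* Suppose the smoothness and strong convexity assumptions (A1) and (A2) hold, let $\lambda>0$ and $\kappa=L/\mu$. Run the algorithm described in the context with step sizes $\eta=(\lambda+L)^{-1}$ and $\gamma=\frac{\lambda+L}{2\lambda L}$, and with a number $K$ of inner-loop iterations of order $K=\tilde{\mathcal{O}}\big(\frac{\lambda+L}{\lambda+\mu}\big)$ satisfying $\big(2+64L_w^2(1/\mu_g)^2\lambda^2\big)(1-\eta\mu_\ell)^K\le(1-\gamma L_g)^4$ (such a choice of $K$ being possible). Then $\boldsymbol{w}_t^{(g)}$ converges to $\widetilde{\boldsymbol{w}}^{(g)}$ linearly at rate $1-\frac{\lambda+L}{4\kappa(\lambda+\mu)}$, and $\boldsymbol{w}_{t,0}^{(i)}$ converges to $\widetilde{\boldsymbol{w}}^{(i)}$ linearly at the same rate for any $i\in[m]$. Consequently, to find an $\varepsilon$-solution, i.e. to reach $\|\boldsymbol{w}_T^{(g)}-\widetilde{\boldsymbol{w}}^{(g)}\|^2\le\varepsilon$ and $\|\boldsymbol{w}_{T,0}^{(i)}-\widetilde{\boldsymbol{w}}^{(i)}\|^2\le\varepsilon$, the algorithm needs (i) a number of communication rounds equal to $\mathcal{O}\big(\kappa\cdot\frac{\lambda+\mu}{\lambda+L}\cdot\log\frac1\varepsilon\big)$, and (ii) a number of gradient evaluations equal to $\tilde{\mathcal{O}}\big(\kappa\cdot\log\frac1\varepsilon\big)$.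
   Context: Setting. For $i\in[m]=\{1,\dots,m\}$, client $i$ has a data set $S_i=\{z_{ij}\}_{j\in[n_i]}$; $\ell(\boldsymbol{w},z)$ is a loss function differentiable in $\boldsymbol{w}\in\mathbb{R}^d$, and $L_i(\boldsymbol{w},S_i)=\frac1{n_i}\sum_{j=1}^{n_i}\ell(\boldsymbol{w},z_{ij})$. For $\lambda>0$ let $h_i(\boldsymbol{w}^{(i)},\boldsymbol{w}^{(g)})=L_i(\boldsymbol{w}^{(i)},S_i)+\frac\lambda2\|\boldsymbol{w}^{(g)}-\boldsymbol{w}^{(i)}\|^2$, and let $(\widetilde{\boldsymbol{w}}^{(g)},\{\widetilde{\boldsymbol{w}}^{(i)}\}_{i=1}^m)$ be the minimizer of $\frac1m\sum_{i=1}^m h_i(\boldsymbol{w}^{(i)},\boldsymbol{w}^{(g)})$ over all $\boldsymbol{w}^{(g)},\boldsymbol{w}^{(1)},\dots,\boldsymbol{w}^{(m)}\in\mathbb{R}^d$. Assumptions. (A1) $\|\nabla\ell(x,z)-\nabla\ell(y,z)\|\le L\|x-y\|$ for all $x,y\in\mathbb{R}^d$ and all $z$. (A2) Each $L_i(\cdot,S_i)$ is $\mu$-strongly convex, $\mu>0$. Constants: $\mu_g=\frac{\lambda\mu}{\lambda+\mu}$, $L_g=\frac{\lambda L}{\lambda+L}$, $\mu_\ell=\mu+\lambda$, $L_\ell=L+\lambda$, $L_w=\frac{\lambda}{\lambda+\mu}$. Algorithm (deterministic federated gradient descent with $K$ local steps). Start from an arbitrary global model $\boldsymbol{w}_1^{(g)}$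 and arbitrary local models $\boldsymbol{w}_{0,K}^{(i)}$, $i\in[m]$. For rounds $t=1,2,\dots$: for each $i$ set $\boldsymbol{w}_{t,0}^{(i)}=\boldsymbol{w}_{t-1,K}^{(i)}$; for $k=0,\dots,K-1$ set $\boldsymbol{w}_{t,k+1}^{(i)}=\boldsymbol{w}_{t,k}^{(i)}-\eta\big(\nabla L_i(\boldsymbol{w}_{t,k}^{(i)},S_i)+\lambda(\boldsymbol{w}_{t,k}^{(i)}-\boldsymbol{w}_t^{(g)})\big)$; then set $\boldsymbol{w}_{t+1}^{(g)}=\boldsymbol{w}_t^{(g)}-\frac{\gamma}{m}\sum_{i=1}^m\lambda(\boldsymbol{w}_t^{(g)}-\boldsymbol{w}_{t,K}^{(i)})$. Each round $t$ is one communication round; the number of gradient evaluations (per client) in $T$ rounds is $KT$. Conventions: a sequence $x_t$ converges to $x$ linearly at rate $r\in(0,1)$ if there is a constant $C$ independent of $t$ (possibly depending on the initialization and problem parameters) with $\|x_t-x\|^2\le Cr^t$ for all $t$. $\mathcal{O}(\cdot)$ describes the behaviour as $\varepsilon\to0$ (the initial error enters only through the logarithm); $\tilde{\mathcal{O}}(\cdot)$ hides in addition factors logarithmic in $\kappa$. *)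

theory Defs
  imports "HOL-Analysis.Analysis"
begin

definition grad :: "('a::real_inner \<Rightarrow> real) \<Rightarrow> 'a \<Rightarrow> 'a"
  where "grad f x = (THE D. GDERIV f x :> D)"

definition strongly_convex :: "real \<Rightarrow> ('a::real_inner \<Rightarrow> real) \<Rightarrow> bool"
  where "strongly_convex \<mu> f \<longleftrightarrow>
    (\<forall>x y. \<forall>t\<in>{0..1}. f (t *\<^sub>R x + (1 - t) *\<^sub>R y)
        \<le> t * f x + (1 - t) * f y - \<mu> / 2 * t * (1 - t) * (norm (x - y))\<^sup>2)"

text \<open>Clients are indexed by \<open>{1..m}\<close>; client \<open>i\<close> holds the data \<open>z i 1, \<dots>, z i (n i)\<close>.\<close>

definition client_loss ::
    "('a \<Rightarrow> 'z \<Rightarrow> real) \<Rightarrow> (nat \<Rightarrow> nat) \<Rightarrow> (nat \<Rightarrow> nat \<Rightarrow> 'z) \<Rightarrow> nat \<Rightarrow> 'a \<Rightarrow> real"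
  where "client_loss l n z i w = 1 / real (n i) * (\<Sum>j=1..n i. l w (z i j))"

definition client_objective ::
    "('a::real_inner \<Rightarrow> 'z \<Rightarrow> real) \<Rightarrow> (nat \<Rightarrow> nat) \<Rightarrow> (nat \<Rightarrow> nat \<Rightarrow> 'z) \<Rightarrow> real \<Rightarrow> nat \<Rightarrow> 'a \<Rightarrow> 'a \<Rightarrow> real"
  where "client_objective l n z lam i v wg =
    client_loss l n z i v + lam / 2 * (norm (wg - v))\<^sup>2"

definition global_objective ::
    "('a::real_inner \<Rightarrow> 'z \<Rightarrow> real) \<Rightarrow> nat \<Rightarrow> (nat \<Rightarrow> nat) \<Rightarrow> (nat \<Rightarrow> nat \<Rightarrow> 'z) \<Rightarrow> real
      \<Rightarrow> 'a \<times> (nat \<Rightarrow> 'a) \<Rightarrow> real"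
  where "global_objective l m n z lam =
    (\<lambda>(wg, v). 1 / real m * (\<Sum>i=1..m. client_objective l n z lam i (v i) wg))"

definition fl_minimizer ::
    "('a::real_inner \<Rightarrow> 'z \<Rightarrow> real) \<Rightarrow> nat \<Rightarrow> (nat \<Rightarrow> nat) \<Rightarrow> (nat \<Rightarrow> nat \<Rightarrow> 'z) \<Rightarrow> real
      \<Rightarrow> 'a \<Rightarrow> (nat \<Rightarrow> 'a) \<Rightarrow> bool"
  where "fl_minimizer l m n z lam wg v \<longleftrightarrow>
    is_arg_min (global_objective l m n z lam) (\<lambda>_. True) (wg, v)"

definition fl_problem ::
    "('a::real_inner \<Rightarrow> 'z \<Rightarrow> real) \<Rightarrow> nat \<Rightarrow> (nat \<Rightarrow> nat) \<Rightarrow> (nat \<Rightarrow> nat \<Rightarrow> 'z)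
      \<Rightarrow> real \<Rightarrow> real \<Rightarrow> real \<Rightarrow> bool"
  where "fl_problem l m n z lam \<mu> L \<longleftrightarrow>
    1 \<le> m \<and> (\<forall>i\<in>{1..m}. 1 \<le> n i) \<and> 0 < lam \<and> 0 < \<mu> \<and>
    (\<forall>s w. (\<lambda>w. l w s) differentiable (at w)) \<and>
    (\<forall>s x y. norm (grad (\<lambda>w. l w s) x - grad (\<lambda>w. l w s) y) \<le> L * norm (x - y)) \<and>
    (\<forall>i\<in>{1..m}. strongly_convex \<mu> (client_loss l n z i))"

text \<open>\<open>wg t\<close> is the global model of round \<open>t \<ge> 1\<close> and \<open>wl t k i\<close> the \<open>k\<close>-th local
  iterate of client \<open>i\<close> in round \<open>t\<close>.  The initial values \<open>wg 1\<close> and \<open>wl 0 K i\<close> are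
  unconstrained.\<close>

definition fed_gd_run ::
    "('a::real_inner \<Rightarrow> 'z \<Rightarrow> real) \<Rightarrow> nat \<Rightarrow> (nat \<Rightarrow> nat) \<Rightarrow> (nat \<Rightarrow> nat \<Rightarrow> 'z) \<Rightarrow> real
      \<Rightarrow> real \<Rightarrow> real \<Rightarrow> nat \<Rightarrow> (nat \<Rightarrow> 'a) \<Rightarrow> (nat \<Rightarrow> nat \<Rightarrow> nat \<Rightarrow> 'a) \<Rightarrow> bool"
  where "fed_gd_run l m n z lam \<eta> \<gamma> K wg wl \<longleftrightarrow>
    (\<forall>t\<ge>1.
      (\<forall>i\<in>{1..m}. wl t 0 i = wl (t - 1) K i \<and>
        (\<forall>k<K. wl t (k + 1) i = wl t k i -
            \<eta> *\<^sub>R (grad (client_loss l n z i) (wl t k i) + lam *\<^sub>R (wl t k i - wg t)))) \<and>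
      wg (t + 1) = wg t - (\<gamma> / real m) *\<^sub>R (\<Sum>i=1..m. lam *\<^sub>R (wg t - wl t K i)))"

definition mu_g :: "real \<Rightarrow> real \<Rightarrow> real"
  where "mu_g lam \<mu> = lam * \<mu> / (lam + \<mu>)"

definition L_g :: "real \<Rightarrow> real \<Rightarrow> real"
  where "L_g lam L = lam * L / (lam + L)"

definition mu_l :: "real \<Rightarrow> real \<Rightarrow> real"
  where "mu_l lam \<mu> = \<mu> + lam"

definition L_w :: "real \<Rightarrow> real \<Rightarrow> real"
  where "L_w lam \<mu> = lam / (lam + \<mu>)"

definition step_local :: "real \<Rightarrow> real \<Rightarrow> real"
  where "step_local lam L = 1 / (lam + L)"

definition step_global :: "real \<Rightarrow> real \<Rightarrow> real"
  where "step_global lam L = (lam + L) / (2 * lam * L)"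

definition admissible_K :: "real \<Rightarrow> real \<Rightarrow> real \<Rightarrow> nat \<Rightarrow> bool"
  where "admissible_K lam \<mu> L K \<longleftrightarrow>
    (2 + 64 * (L_w lam \<mu>)\<^sup>2 * (1 / mu_g lam \<mu>)\<^sup>2 * lam\<^sup>2)
        * (1 - step_local lam L * mu_l lam \<mu>) ^ K
      \<le> (1 - step_global lam L * L_g lam L) ^ 4"

text \<open>\<open>K = soft-O((lam + L) / (lam + \<mu>))\<close> with explicit constants: factor \<open>A\<close> and
  \<open>p\<close>-th power of the logarithm.  The \<open>1 +\<close> covers condition number \<open>1\<close>; the problem
  assumptions imply \<open>L / \<mu> \<ge> 1\<close>.\<close>

definition K_order :: "real \<Rightarrow> nat \<Rightarrow> real \<Rightarrow> real \<Rightarrow> real \<Rightarrow> nat \<Rightarrow> bool"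
  where "K_order A p lam \<mu> L K \<longleftrightarrow>
    real K \<le> A * (1 + ln (L / \<mu>)) ^ p * ((lam + L) / (lam + \<mu>))"

definition converges_linearly :: "(nat \<Rightarrow> 'a::real_normed_vector) \<Rightarrow> 'a \<Rightarrow> real \<Rightarrow> bool"
  where "converges_linearly x a r \<longleftrightarrow>
    0 < r \<and> r < 1 \<and> (\<exists>C. \<forall>t\<ge>1. (norm (x t - a))\<^sup>2 \<le> C * r ^ t)"

definition eps_solution ::
    "nat \<Rightarrow> (nat \<Rightarrow> 'a::real_normed_vector) \<Rightarrow> (nat \<Rightarrow> nat \<Rightarrow> nat \<Rightarrow> 'a) \<Rightarrow> 'a \<Rightarrow> (nat \<Rightarrow> 'a)
      \<Rightarrow> real \<Rightarrow> nat \<Rightarrow> bool"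
  where "eps_solution m wg wl wg_opt wl_opt \<epsilon> T \<longleftrightarrow>
    (norm (wg T - wg_opt))\<^sup>2 \<le> \<epsilon> \<and> (\<forall>i\<in>{1..m}. (norm (wl T 0 i - wl_opt i))\<^sup>2 \<le> \<epsilon>)"

end

theory Submission
  imports Defs
begin

text \<open>The proof is operator-theoretic.  The gradient \<open>g\<close> of a \<open>\<mu>\<close>-strongly convex, \<open>L\<close>-smooth
  function deviates from \<open>(\<mu> + L)/2 \<cdot> id\<close> by a \<open>(L - \<mu>)/2\<close>-Lipschitz map, and a gradient step on
  any such operator contracts distances.  This class is closed under averages and shifts, and
  passing to the Moreau envelope turns \<open>(\<mu>, L)\<close> into \<open>(\<mu>\<^sub>g, L\<^sub>g)\<close>.  Hence local steps contract
  towards the proximal points, while the global update is an inexact gradient step on the averaged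
  envelope.  With \<open>e\<close> the global error and \<open>d\<close> the mean distance of the clients to their proximal
  points, \<open>e + 4\<gamma>\<lambda>d\<close> shrinks by \<open>1 - \<gamma>\<mu>\<^sub>g/3\<close> per round, whose square is at most
  \<open>1 - \<gamma>\<mu>\<^sub>g/2\<close>.\<close>

section \<open>Operators deviating from a multiple of the identity by a Lipschitz map\<close>

text \<open>For \<open>a \<le> b\<close> this is the cocoercivity condition
  \<open>\<langle>\<Delta>g - a \<Delta>x, b \<Delta>x - \<Delta>g\<rangle> \<ge> 0\<close>, written as a ball condition because the latter
  visibly passes to averages.\<close>

definition pinched :: "real \<Rightarrow> real \<Rightarrow> ('a::real_inner \<Rightarrow> 'a) \<Rightarrow> bool"
  where "pinched a b g \<longleftrightarrow>
    (\<forall>x y. norm ((g x - g y) - ((a + b) / 2) *\<^sub>R (x - y)) \<le> (b - a) / 2 * norm (x - y))"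

lemma pinchedD:
  "pinched a b g \<Longrightarrow>
    norm ((g x - g y) - ((a + b) / 2) *\<^sub>R (x - y)) \<le> (b - a) / 2 * norm (x - y)"
  by (simp add: pinched_def)

text \<open>Thales: the ball has the segment from \<open>a *\<^sub>R d\<close> to
  \<open>b *\<^sub>R d\<close> as a diameter, and \<open>D\<close> lies in it iff it sees that
  segment under an angle that is not acute. Since \<open>a \<le> b\<close>, the radius is
  nonnegative and both sides may be squared.\<close>

lemma ball_iff_inner:
  fixes D d :: "'a::real_inner"
  assumes "a \<le> b"
  shows "norm (D - ((a + b) / 2) *\<^sub>R d) \<le> (b - a) / 2 * norm d \<longleftrightarrow>
    0 \<le> inner (D - a *\<^sub>R d) (b *\<^sub>R d - D)"
proof -
  have "0 \<le> (b - a) / 2 * norm d" using assms by simp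
  then have "norm (D - ((a + b) / 2) *\<^sub>R d) \<le> (b - a) / 2 * norm d \<longleftrightarrow>
      (norm (D - ((a + b) / 2) *\<^sub>R d))\<^sup>2 \<le> ((b - a) / 2 * norm d)\<^sup>2"
    by (metis abs_le_square_iff abs_norm_cancel abs_of_nonneg)
  also have "((b - a) / 2 * norm d)\<^sup>2 = (norm (D - ((a + b) / 2) *\<^sub>R d))\<^sup>2
      + inner (D - a *\<^sub>R d) (b *\<^sub>R d - D)"
    unfolding power_mult_distrib power2_norm_eq_inner
    by (simp add: inner_diff_left inner_diff_right inner_commute power2_eq_square field_simps)
  finally show ?thesis by simp
qed

lemma pinched_iff_inner:
  assumes "a \<le> b"
  shows "pinched a b g \<longleftrightarrow>
    (\<forall>x y. 0 \<le> inner ((g x - g y) - a *\<^sub>R (x - y)) (b *\<^sub>R (x - y) - (g x - g y)))"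
  unfolding pinched_def ball_iff_inner[OF assms] ..

text \<open>The difference of the two steps is a multiple of \<open>x - y\<close> minus
  \<open>\<eta>\<close> times the deviation that \<open>pinched\<close> bounds. The bound on
  \<open>\<eta> * (a + b)\<close> keeps the multiplier nonnegative, so the triangle inequality adds
  up to exactly \<open>1 - \<eta> * a\<close>.\<close>

lemma pinched_gradient_step:
  assumes g: "pinched a b g" and "0 \<le> \<eta>" "\<eta> * (a + b) \<le> 2"
  shows "norm ((x - \<eta> *\<^sub>R g x) - (y - \<eta> *\<^sub>R g y)) \<le> (1 - \<eta> * a) * norm (x - y)"
proof -
  let ?c = "(a + b) / 2"
  have "(x - \<eta> *\<^sub>R g x) - (y - \<eta> *\<^sub>R g y)
      = (1 - \<eta> * ?c) *\<^sub>R (x - y) - \<eta> *\<^sub>R ((g x - g y) - ?c *\<^sub>R (x - y))"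
    by (simp add: algebra_simps)
  also have "norm \<dots> \<le> (1 - \<eta> * ?c) * norm (x - y) + \<eta> * ((b - a) / 2 * norm (x - y))"
    using assms mult_left_mono[OF pinchedD[OF g, of x y] \<open>0 \<le> \<eta>\<close>]
    by (intro norm_triangle_le_diff add_mono) auto
  also have "\<dots> = (1 - \<eta> * a) * norm (x - y)"
    by (simp add: field_simps)
  finally show ?thesis .
qed

lemma pinched_lipschitz:
  assumes g: "pinched a b g" and "0 \<le> a + b"
  shows "norm (g x - g y) \<le> b * norm (x - y)"
proof -
  have "norm (g x - g y) \<le> norm ((g x - g y) - ((a + b) / 2) *\<^sub>R (x - y))
      + norm (((a + b) / 2) *\<^sub>R (x - y))"
    by (metis diff_add_cancel norm_triangle_ineq)
  also have "\<dots> \<le> (b - a) / 2 * norm (x - y) + (a + b) / 2 * norm (x - y)"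
    using assms pinchedD[OF g, of x y] by (intro add_mono) auto
  finally show ?thesis by (simp add: field_simps)
qed

lemma pinched_expansion:
  assumes g: "pinched a b g"
  shows "a * norm (x - y) \<le> norm (g x - g y)"
proof -
  have "norm (((a + b) / 2) *\<^sub>R (x - y)) \<le> norm (g x - g y)
      + norm ((g x - g y) - ((a + b) / 2) *\<^sub>R (x - y))"
    by (metis add.commute diff_add_cancel norm_minus_commute norm_triangle_sub)
  moreover have "(a + b) / 2 * norm (x - y) \<le> norm (((a + b) / 2) *\<^sub>R (x - y))"
    by (auto intro!: mult_right_mono)
  ultimately show ?thesis
    using pinchedD[OF g, of x y] by (simp add: field_simps)
qed

text \<open>For \<open>g\<close> the gradient of a client loss, the shifted operator is the gradient
  of the client objective with the global model frozen at \<open>w\<close>.\<close>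

lemma pinched_shift:
  assumes "pinched a b g"
  shows "pinched (a + lam) (b + lam) (\<lambda>x. g x + lam *\<^sub>R (x - w))"
  unfolding pinched_def
proof (intro allI)
  fix x y
  have "(g x + lam *\<^sub>R (x - w)) - (g y + lam *\<^sub>R (y - w))
      - ((a + lam + (b + lam)) / 2) *\<^sub>R (x - y) = (g x - g y) - ((a + b) / 2) *\<^sub>R (x - y)"
    by (simp add: algebra_simps add_divide_distrib)
  then show "norm ((g x + lam *\<^sub>R (x - w)) - (g y + lam *\<^sub>R (y - w))
      - ((a + lam + (b + lam)) / 2) *\<^sub>R (x - y)) \<le> (b + lam - (a + lam)) / 2 * norm (x - y)"
    using pinchedD[OF assms, of x y] by (simp only: add_diff_cancel_right)
qed

lemma pinched_mean:
  assumes g: "\<And>i. i \<in> I \<Longrightarrow> pinched a b (g i)" and I: "finite I" "I \<noteq> {}"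
  shows "pinched a b (\<lambda>x. (1 / real (card I)) *\<^sub>R (\<Sum>i\<in>I. g i x))"
  unfolding pinched_def
proof (intro allI)
  fix x y
  let ?k = "1 / real (card I)"
  have pos: "card I > 0" using I by (simp add: card_gt_0_iff)
  have "?k *\<^sub>R (\<Sum>i\<in>I. g i x) - ?k *\<^sub>R (\<Sum>i\<in>I. g i y) - ((a + b) / 2) *\<^sub>R (x - y)
      = ?k *\<^sub>R (\<Sum>i\<in>I. (g i x - g i y) - ((a + b) / 2) *\<^sub>R (x - y))"
    using pos by (simp add: sum_subtractf scaleR_right_diff_distrib sum_constant_scaleR del: sum_constant)
  also have "norm \<dots> = ?k * norm (\<Sum>i\<in>I. (g i x - g i y) - ((a + b) / 2) *\<^sub>R (x - y))"
    by simp
  also have "\<dots> \<le> ?k * (\<Sum>i\<in>I. (b - a) / 2 * norm (x - y))"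
    by (intro mult_left_mono sum_norm_le pinchedD g) auto
  also have "\<dots> = (b - a) / 2 * norm (x - y)"
    using pos by simp
  finally show "norm (?k *\<^sub>R (\<Sum>i\<in>I. g i x) - ?k *\<^sub>R (\<Sum>i\<in>I. g i y) - ((a + b) / 2) *\<^sub>R (x - y))
    \<le> (b - a) / 2 * norm (x - y)" .
qed

section \<open>Proximal points and the Moreau envelope\<close>

text \<open>The local gradient step with step size \<open>1 / (lam + L)\<close> is a contraction,
  and its Banach fixed point is a zero of the shifted operator.\<close>

lemma pinched_resolvent_exists:
  fixes g :: "'a::{real_inner, complete_space} \<Rightarrow> 'a"
  assumes g: "pinched \<mu> L g" and "0 < \<mu>" "\<mu> \<le> L" "0 < lam"
  shows "\<exists>p. g p + lam *\<^sub>R (p - w) = 0"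
proof -
  let ?\<eta> = "1 / (lam + L)"
  let ?f = "\<lambda>x. x - ?\<eta> *\<^sub>R (g x + lam *\<^sub>R (x - w))"
  have "dist (?f x) (?f y) \<le> (1 - ?\<eta> * (\<mu> + lam)) * dist x y" for x y
    unfolding dist_norm using assms
    by (intro pinched_gradient_step[OF pinched_shift[OF g]]) (auto simp: field_simps)
  moreover have "0 \<le> 1 - ?\<eta> * (\<mu> + lam)" "1 - ?\<eta> * (\<mu> + lam) < 1"
    using assms by (auto simp: field_simps)
  ultimately have "\<exists>!x. ?f x = x"
    by (intro banach_fix_type[where c = "1 - ?\<eta> * (\<mu> + lam)"]) auto
  then obtain p where "p - ?\<eta> *\<^sub>R (g p + lam *\<^sub>R (p - w)) = p" by blast
  then have "?\<eta> *\<^sub>R (g p + lam *\<^sub>R (p - w)) = 0" by (metis add_diff_cancel_left' diff_add_cancel diff_self)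
  then show ?thesis using assms by (intro exI[of _ p]) (simp del: scaleR_right_diff_distrib)
qed

lemma pinched_resolvent_lipschitz:
  assumes g: "pinched \<mu> L g" and lam: "0 < lam" "0 < \<mu>"
    and P: "\<And>w. g (P w) + lam *\<^sub>R (P w - w) = 0"
  shows "norm (P x - P y) \<le> L_w lam \<mu> * norm (x - y)"
proof -
  \<comment> \<open>Shifting around 0 isolates \<open>w\<close>: the map that \<open>P\<close>
    inverts, up to the factor \<open>lam\<close>, expands distances by at least
    \<open>\<mu> + lam\<close>.\<close>
  have eq: "g (P x) + lam *\<^sub>R (P x - 0) = lam *\<^sub>R x" for x
    using P[of x] by (simp add: algebra_simps)
  have "(\<mu> + lam) * norm (P x - P y) \<le> norm (lam *\<^sub>R x - lam *\<^sub>R y)"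
    using pinched_expansion[OF pinched_shift[OF g, of lam 0], of "P x" "P y"] unfolding eq .
  also have "\<dots> = lam * norm (x - y)"
    using lam by (simp flip: scaleR_right_diff_distrib)
  finally show ?thesis using lam by (simp add: L_w_def field_simps)
qed

text \<open>The operator \<open>lam *\<^sub>R (w - P w)\<close> is the gradient of the Moreau
  envelope and equals \<open>g (P w)\<close>. Substituting
  \<open>w = P w + (1 / lam) *\<^sub>R g (P w)\<close> turns each factor of the inner product
  condition into a positive multiple of the same factor for \<open>g\<close> at the proximal
  points.\<close>

lemma pinched_envelope:
  assumes g: "pinched \<mu> L g" and pos: "0 < \<mu>" "\<mu> \<le> L" "0 < lam"
    and P: "\<And>w. g (P w) + lam *\<^sub>R (P w - w) = 0"
  shows "pinched (mu_g lam \<mu>) (L_g lam L) (\<lambda>w. lam *\<^sub>R (w - P w))"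
proof -
  have le: "mu_g lam \<mu> \<le> L_g lam L"
    using pos by (simp add: mu_g_def L_g_def field_simps)
  have eq: "lam *\<^sub>R (w - P w) = g (P w)" for w
    using P[of w] by (simp add: algebra_simps eq_neg_iff_add_eq_0)
  have w: "w = P w + (1 / lam) *\<^sub>R g (P w)" for w
    unfolding eq[symmetric] using pos by simp
  show ?thesis
    unfolding pinched_iff_inner[OF le]
  proof (intro allI)
    fix x y
    let ?D = "g (P x) - g (P y)" and ?d = "P x - P y"
    have xy: "x - y = ?d + (1 / lam) *\<^sub>R ?D"
      by (subst w[of x], subst w[of y]) (simp add: algebra_simps)
    have "?D - mu_g lam \<mu> *\<^sub>R (x - y) = (1 - mu_g lam \<mu> / lam) *\<^sub>R ?D - mu_g lam \<mu> *\<^sub>R ?d"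
      unfolding xy by (simp add: algebra_simps)
    also have "1 - mu_g lam \<mu> / lam = lam / (lam + \<mu>)"
      using pos by (simp add: mu_g_def add_divide_distrib[symmetric] diff_divide_eq_iff)
    also have "(lam / (lam + \<mu>)) *\<^sub>R ?D - mu_g lam \<mu> *\<^sub>R ?d = (lam / (lam + \<mu>)) *\<^sub>R (?D - \<mu> *\<^sub>R ?d)"
      by (simp add: mu_g_def scaleR_right_diff_distrib)
    finally have 1: "?D - mu_g lam \<mu> *\<^sub>R (x - y) = (lam / (lam + \<mu>)) *\<^sub>R (?D - \<mu> *\<^sub>R ?d)" .
    have "L_g lam L *\<^sub>R (x - y) - ?D = L_g lam L *\<^sub>R ?d - (1 - L_g lam L / lam) *\<^sub>R ?D"
      unfolding xy by (simp add: algebra_simps)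
    also have "1 - L_g lam L / lam = lam / (lam + L)"
      using pos by (simp add: L_g_def add_divide_distrib[symmetric] diff_divide_eq_iff)
    also have "L_g lam L *\<^sub>R ?d - (lam / (lam + L)) *\<^sub>R ?D = (lam / (lam + L)) *\<^sub>R (L *\<^sub>R ?d - ?D)"
      by (simp add: L_g_def scaleR_right_diff_distrib)
    finally have 2: "L_g lam L *\<^sub>R (x - y) - ?D = (lam / (lam + L)) *\<^sub>R (L *\<^sub>R ?d - ?D)" .
    have "0 \<le> inner (?D - \<mu> *\<^sub>R ?d) (L *\<^sub>R ?d - ?D)"
      using g pinched_iff_inner[OF pos(2)] by blast
    then show "0 \<le> inner (lam *\<^sub>R (x - P x) - lam *\<^sub>R (y - P y) - mu_g lam \<mu> *\<^sub>R (x - y))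
        (L_g lam L *\<^sub>R (x - y) - (lam *\<^sub>R (x - P x) - lam *\<^sub>R (y - P y)))"
      unfolding eq 1 2 using pos by simp
  qed
qed

section \<open>Gradients of smooth and strongly convex functions\<close>

lemma GDERIV_unique: "GDERIV f x :> D \<Longrightarrow> GDERIV f x :> D' \<Longrightarrow> D = D'"
  unfolding gderiv_def
  using has_derivative_unique[of f "\<lambda>h. inner h D" x "\<lambda>h. inner h D'"]
  by (simp add: fun_eq_iff vector_eq_ldot)

text \<open>As \<open>grad\<close> is a definite description, it carries information only once a
  gradient exists and is unique. Existence is the Riesz representation of the derivative, with
  coordinates read off \<open>Basis\<close>.\<close>

lemma GDERIV_grad:
  fixes f :: "'a::euclidean_space \<Rightarrow> real"
  assumes "f differentiable (at x)"
  shows "GDERIV f x :> grad f x"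
proof -
  from assms obtain f' where f': "(f has_derivative f') (at x)"
    by (auto simp: differentiable_def)
  then interpret linear f' by (rule has_derivative_linear)
  have eq: "f' = (\<lambda>h. inner h (\<Sum>b\<in>Basis. f' b *\<^sub>R b))"
  proof
    fix h
    have "f' h = f' (\<Sum>b\<in>Basis. inner h b *\<^sub>R b)" by (simp add: euclidean_representation)
    also have "\<dots> = (\<Sum>b\<in>Basis. inner h b * f' b)" by (simp add: sum scale)
    finally show "f' h = inner h (\<Sum>b\<in>Basis. f' b *\<^sub>R b)"
      by (simp add: inner_sum_right mult.commute)
  qed
  then have "\<exists>D. GDERIV f x :> D"
    unfolding gderiv_def using has_derivative_eq_rhs[OF f' eq] by blast
  then have "\<exists>!D. GDERIV f x :> D" using GDERIV_unique by blast
  then show ?thesis unfolding grad_def by (rule theI')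
qed

lemma grad_eq: "GDERIV f x :> D \<Longrightarrow> grad f x = D"
  unfolding grad_def by (blast intro: the_equality GDERIV_unique)

lemma GDERIV_line:
  assumes "GDERIV f (x + t *\<^sub>R d) :> D"
  shows "((\<lambda>t. f (x + t *\<^sub>R d)) has_real_derivative inner d D) (at t)"
proof -
  have "((\<lambda>t. x + t *\<^sub>R d) has_derivative (\<lambda>h. h *\<^sub>R d)) (at t)"
    by (auto intro!: derivative_eq_intros)
  from has_derivative_compose[OF this assms[unfolded gderiv_def]]
  have "((\<lambda>t. f (x + t *\<^sub>R d)) has_derivative (\<lambda>h. inner (h *\<^sub>R d) D)) (at t)" .
  then show ?thesis
    by (simp add: has_field_derivative_def mult_commute_abs)
qed

text \<open>Descent lemma: along the segment, \<open>f\<close> minus its linear part and the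
  quadratic term has nonpositive derivative by Cauchy-Schwarz and the Lipschitz bound.\<close>

lemma smooth_upper_bound:
  assumes g: "\<And>x. GDERIV f x :> g x"
    and L: "\<And>x y. norm (g x - g y) \<le> L * norm (x - y)"
  shows "f y \<le> f x + inner (g x) (y - x) + L / 2 * (norm (y - x))\<^sup>2"
proof -
  let ?d = "y - x"
  let ?\<phi> = "\<lambda>t. f (x + t *\<^sub>R ?d) - t * inner (g x) ?d - L / 2 * t\<^sup>2 * (norm ?d)\<^sup>2"
  have "?\<phi> 1 \<le> ?\<phi> 0"
  proof (rule DERIV_nonpos_imp_nonincreasing[of 0 1])
    fix t :: real assume t: "0 \<le> t" "t \<le> 1"
    have der: "(?\<phi> has_real_derivative
        (inner ?d (g (x + t *\<^sub>R ?d)) - inner (g x) ?d - L * t * (norm ?d)\<^sup>2)) (at t)"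
      by (auto intro!: derivative_eq_intros GDERIV_line g)
    have "inner ?d (g (x + t *\<^sub>R ?d)) - inner (g x) ?d = inner (g (x + t *\<^sub>R ?d) - g x) ?d"
      by (metis inner_commute inner_diff_left)
    also have "\<dots> \<le> norm (g (x + t *\<^sub>R ?d) - g x) * norm ?d"
      by (rule norm_cauchy_schwarz)
    also have "\<dots> \<le> L * norm (t *\<^sub>R ?d) * norm ?d"
      using L[of "x + t *\<^sub>R ?d" x] by (intro mult_right_mono) auto
    also have "\<dots> = L * t * (norm ?d)\<^sup>2"
      using t by (simp add: power2_eq_square)
    finally show "\<exists>y. (?\<phi> has_real_derivative y) (at t) \<and> y \<le> 0"
      using der by (intro exI[of _ "inner ?d (g (x + t *\<^sub>R ?d)) - inner (g x) ?d - L * t * (norm ?d)\<^sup>2"]) simp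
  qed simp
  then show ?thesis by simp
qed

text \<open>Divide the convexity inequality at \<open>x + t *\<^sub>R (y - x)\<close> by
  \<open>t\<close> and let \<open>t\<close> tend to 0 from the right.\<close>

lemma strongly_convex_lower_bound:
  assumes f: "strongly_convex \<mu> f" and g: "GDERIV f x :> D"
  shows "f x + inner D (y - x) + \<mu> / 2 * (norm (y - x))\<^sup>2 \<le> f y"
proof -
  let ?d = "y - x"
  have "((\<lambda>t. (f (x + t *\<^sub>R ?d) - f x) / t) \<longlongrightarrow> inner ?d D) (at_right 0)"
    using GDERIV_line[of f x 0 ?d D] g unfolding has_field_derivative_iff
    by (auto intro: filterlim_mono[OF _ order_refl] at_le)
  moreover have "((\<lambda>t. f y - f x - \<mu> / 2 * (1 - t) * (norm ?d)\<^sup>2) \<longlongrightarrow>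
      f y - f x - \<mu> / 2 * (1 - 0) * (norm ?d)\<^sup>2) (at_right 0)"
    by (intro tendsto_intros)
  moreover have "\<forall>\<^sub>F t in at_right 0. (f (x + t *\<^sub>R ?d) - f x) / t
      \<le> f y - f x - \<mu> / 2 * (1 - t) * (norm ?d)\<^sup>2"
    unfolding eventually_at_right_field
  proof (intro exI[of _ 1] conjI allI impI)
    fix t :: real assume t: "0 < t" "t < 1"
    have "x + t *\<^sub>R ?d = t *\<^sub>R y + (1 - t) *\<^sub>R x" by (simp add: algebra_simps)
    with f t have "f (x + t *\<^sub>R ?d) \<le> t * f y + (1 - t) * f x - \<mu> / 2 * t * (1 - t) * (norm ?d)\<^sup>2"
      by (auto simp: strongly_convex_def)
    then show "(f (x + t *\<^sub>R ?d) - f x) / t \<le> f y - f x - \<mu> / 2 * (1 - t) * (norm ?d)\<^sup>2"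
      using t by (simp add: field_simps)
  qed simp
  ultimately have "inner ?d D \<le> f y - f x - \<mu> / 2 * (1 - 0) * (norm ?d)\<^sup>2"
    by (intro tendsto_le[OF _ _ _]) auto
  then show ?thesis by (simp add: inner_commute)
qed

text \<open>Between 0 and a unit vector the quadratic lower and upper bounds share their linear
  term, which leaves \<open>\<mu> / 2 \<le> L / 2\<close>.\<close>

lemma strong_convexity_le_smoothness:
  fixes f :: "'a::euclidean_space \<Rightarrow> real"
  assumes "\<And>x. GDERIV f x :> g x" "\<And>x y. norm (g x - g y) \<le> L * norm (x - y)"
    and "strongly_convex \<mu> f"
  shows "\<mu> \<le> L"
proof -
  obtain b :: 'a where b: "b \<in> Basis" using nonempty_Basis by blast
  show ?thesis
    using smooth_upper_bound[of f g L b 0] strongly_convex_lower_bound[of \<mu> f 0 "g 0" b] assms b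
    by simp
qed

text \<open>Baillon--Haddad for \<open>f - \<mu>/2 \<parallel>\<cdot>\<parallel>\<^sup>2\<close>: compare its value at \<open>x\<close> with that after a step of
  length \<open>s\<close> from \<open>y\<close> along the difference of gradients, add the same with \<open>x\<close>, \<open>y\<close> swapped,
  and optimise over \<open>s\<close>.\<close>

lemma pinched_gradient:
  assumes g: "\<And>x. GDERIV f x :> g x"
    and L: "\<And>x y. norm (g x - g y) \<le> L * norm (x - y)"
    and sc: "strongly_convex \<mu> f" and le: "\<mu> \<le> L"
  shows "pinched \<mu> L g"
  unfolding pinched_iff_inner[OF le]
proof (intro allI)
  fix x y
  let ?M = "L - \<mu>"
  let ?D = "\<lambda>x y. (g x - g y) - \<mu> *\<^sub>R (x - y)"
  let ?N = "inner (?D x y) (?D x y)"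
  have half: "0 \<le> f y - f x - inner (g x) (y - x) - \<mu> / 2 * inner (y - x) (y - x)
      - s * inner (?D y x) (?D y x) + ?M / 2 * s\<^sup>2 * inner (?D y x) (?D y x)" for s x y
  proof -
    let ?u = "y - s *\<^sub>R ?D y x"
    have "f x + inner (g x) (?u - x) + \<mu> / 2 * (norm (?u - x))\<^sup>2
        \<le> f y + inner (g y) (?u - y) + L / 2 * (norm (?u - y))\<^sup>2"
      using strongly_convex_lower_bound[OF sc g, of x ?u] smooth_upper_bound[OF g L, of ?u y]
      by linarith
    then show ?thesis
      unfolding power2_norm_eq_inner
      by (simp add: inner_diff_left inner_diff_right inner_commute power2_eq_square algebra_simps)
         (simp add: field_simps)
  qed
  have key: "0 \<le> inner (?D x y) (x - y) - 2 * s * ?N + ?M * s\<^sup>2 * ?N" for s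
  proof -
    have "?D y x = - ?D x y" by (simp add: algebra_simps)
    then have N: "inner (?D y x) (?D y x) = ?N" by (metis inner_minus_left inner_minus_right minus_minus)
    have yx: "inner (y - x) (y - x) = inner (x - y) (x - y)"
      by (simp add: inner_diff_left inner_diff_right)
    have "inner (?D x y) (x - y)
        = - inner (g x) (y - x) - inner (g y) (x - y) - \<mu> * inner (x - y) (x - y)"
      by (simp add: inner_diff_left inner_diff_right algebra_simps)
    then show ?thesis
      using half[of y x s] half[of x y s] unfolding N yx by simp
  qed
  have "?N \<le> ?M * inner (?D x y) (x - y)"
  proof (cases "?M = 0")
    \<comment> \<open>Without a quadratic term in \<open>s\<close> there is no optimal step:
      \<open>key\<close> is affine in \<open>s\<close>, and a large enough \<open>s\<close> refutes
      it unless \<open>?N\<close> vanishes.\<close>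
    case True
    have cancel: "2 * (k / (2 * N)) * N = k" if "\<not> N \<le> 0" for k N :: real
      using that by simp
    have "?N \<le> 0"
    proof (rule ccontr)
      assume "\<not> ?N \<le> 0"
      then have "2 * ((inner (?D x y) (x - y) + 1) / (2 * ?N)) * ?N = inner (?D x y) (x - y) + 1"
        by (rule cancel)
      then show False
        using key[of "(inner (?D x y) (x - y) + 1) / (2 * ?N)"] unfolding True by linarith
    qed
    with True show ?thesis by simp
  next
    case False
    with le have "?M > 0" by simp
    \<comment> \<open>The optimal step length is \<open>s = 1 / M\<close>.\<close>
    have "N \<le> M * k" if "0 < M" "0 \<le> k - 2 * (1 / M) * N + M * (1 / M)\<^sup>2 * N" for M N k :: real
      using that by (simp add: power2_eq_square field_simps)
    from this[OF \<open>?M > 0\<close> key] show ?thesis .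
  qed
  moreover have "inner (?D x y) (L *\<^sub>R (x - y) - (g x - g y))
      = ?M * inner (?D x y) (x - y) - ?N"
    by (simp add: inner_diff_left inner_diff_right algebra_simps)
  ultimately show "0 \<le> inner (?D x y) (L *\<^sub>R (x - y) - (g x - g y))" by simp
qed

section \<open>Client losses and optimality conditions of the federated problem\<close>

lemma GDERIV_minimum:
  assumes f: "GDERIV f x :> D" and min: "\<And>y. f x \<le> f y"
  shows "D = 0"
proof -
  have "((\<lambda>t. f (x + t *\<^sub>R D)) has_real_derivative inner D D) (at 0)"
    using GDERIV_line[of f x 0 D D] f by simp
  then have "inner D D = 0"
    by (rule DERIV_local_min[of _ _ _ 1]) (auto simp: min)
  then show ?thesis by simp
qed

lemma GDERIV_prox_term: "GDERIV (\<lambda>x. lam / 2 * (norm (w - x))\<^sup>2) x :> lam *\<^sub>R (x - w)"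
  unfolding gderiv_def power2_norm_eq_inner
  by (auto intro!: derivative_eq_intros
      simp: inner_diff_left inner_diff_right inner_commute algebra_simps)

lemma fl_problem_client_loss:
  fixes l :: "'a::euclidean_space \<Rightarrow> 'z \<Rightarrow> real"
  assumes "fl_problem l m n z lam \<mu> L" "i \<in> {1..m}"
  shows "GDERIV (client_loss l n z i) x :> grad (client_loss l n z i) x"
    and "norm (grad (client_loss l n z i) x - grad (client_loss l n z i) y) \<le> L * norm (x - y)"
proof -
  let ?k = "1 / real (n i)"
  let ?g = "\<lambda>j x. grad (\<lambda>w. l w (z i j)) x"
  have "1 \<le> n i" using assms unfolding fl_problem_def by blast
  then have n: "real (n i) > 0" by simp
  have gl: "((\<lambda>w. l w s) has_derivative (\<lambda>h. inner h (grad (\<lambda>w. l w s) x))) (at x)" for s x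
    using GDERIV_grad[of "\<lambda>w. l w s" x] assms unfolding gderiv_def by (auto simp: fl_problem_def)
  have der: "GDERIV (client_loss l n z i) x :> ?k *\<^sub>R (\<Sum>j=1..n i. ?g j x)" for x
  proof -
    have "((\<lambda>w. ?k * (\<Sum>j=1..n i. l w (z i j))) has_derivative
        (\<lambda>h. ?k * (\<Sum>j=1..n i. inner h (?g j x)))) (at x)"
      by (intro has_derivative_mult_right has_derivative_sum gl)
    then show ?thesis
      unfolding gderiv_def client_loss_def by (simp add: inner_sum_right)
  qed
  note eq = grad_eq[OF der]
  show "GDERIV (client_loss l n z i) x :> grad (client_loss l n z i) x"
    unfolding eq by (rule der)
  have "norm (?k *\<^sub>R (\<Sum>j=1..n i. ?g j x) - ?k *\<^sub>R (\<Sum>j=1..n i. ?g j y))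
      = ?k * norm (\<Sum>j=1..n i. ?g j x - ?g j y)"
    by (simp add: sum_subtractf flip: scaleR_right_diff_distrib)
  also have "\<dots> \<le> ?k * (\<Sum>j=1..n i. L * norm (x - y))"
    using assms by (intro mult_left_mono sum_norm_le) (auto simp: fl_problem_def)
  also have "\<dots> = L * norm (x - y)" using n by simp
  finally show "norm (grad (client_loss l n z i) x - grad (client_loss l n z i) y)
      \<le> L * norm (x - y)"
    unfolding eq .
qed

lemma fl_problem_pos:
  fixes l :: "'a::euclidean_space \<Rightarrow> 'z \<Rightarrow> real"
  assumes "fl_problem l m n z lam \<mu> L"
  shows "0 < lam" "0 < \<mu>" "\<mu> \<le> L" "1 \<le> m"
proof -
  show m: "0 < lam" "0 < \<mu>" "1 \<le> m" using assms by (auto simp: fl_problem_def)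
  then have "1 \<in> {1..m}" by simp
  then show "\<mu> \<le> L"
    using assms
    by (intro strong_convexity_le_smoothness[OF fl_problem_client_loss[OF assms, of 1]])
       (auto simp: fl_problem_def)
qed

lemma fl_problem_pinched:
  fixes l :: "'a::euclidean_space \<Rightarrow> 'z \<Rightarrow> real"
  assumes "fl_problem l m n z lam \<mu> L" "i \<in> {1..m}"
  shows "pinched \<mu> L (grad (client_loss l n z i))"
  using assms fl_problem_pos(3)[OF assms(1)]
  by (intro pinched_gradient[OF fl_problem_client_loss[OF assms]]) (auto simp: fl_problem_def)

text \<open>A joint minimizer is minimal in each block of variables separately, so Fermat's rule
  applies after changing one local model, or only the global one. In the latter case the client
  losses cancel and the proximal terms remain.\<close>

lemma fl_minimizer_stationary:
  fixes l :: "'a::euclidean_space \<Rightarrow> 'z \<Rightarrow> real"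
  assumes fl: "fl_problem l m n z lam \<mu> L" and min: "fl_minimizer l m n z lam w v"
  shows "i \<in> {1..m} \<Longrightarrow> grad (client_loss l n z i) (v i) + lam *\<^sub>R (v i - w) = 0"
    and "(\<Sum>i=1..m. lam *\<^sub>R (w - v i)) = 0"
proof -
  let ?c = "client_objective l n z lam"
  have m: "real m > 0" using fl by (auto simp: fl_problem_def)
  have le: "(\<Sum>i=1..m. ?c i (v i) w) \<le> (\<Sum>i=1..m. ?c i (v' i) w')" for v' w'
  proof -
    have "global_objective l m n z lam (w, v) \<le> global_objective l m n z lam (w', v')"
      using min by (simp add: fl_minimizer_def is_arg_min_linorder)
    then show ?thesis using m by (simp add: global_objective_def divide_le_cancel)
  qed
  show "grad (client_loss l n z i) (v i) + lam *\<^sub>R (v i - w) = 0" if i: "i \<in> {1..m}"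
  proof (rule GDERIV_minimum)
    show "GDERIV (\<lambda>x. ?c i x w) (v i) :> grad (client_loss l n z i) (v i) + lam *\<^sub>R (v i - w)"
      unfolding client_objective_def
      by (intro GDERIV_add fl_problem_client_loss(1)[OF fl i] GDERIV_prox_term)
    fix x
    have "(\<Sum>j=1..m. ?c j ((v(i := x)) j) w) = ?c i x w + (\<Sum>j\<in>{1..m} - {i}. ?c j (v j) w)"
      using i by (subst sum.remove[of _ i]) auto
    moreover have "(\<Sum>j=1..m. ?c j (v j) w) = ?c i (v i) w + (\<Sum>j\<in>{1..m} - {i}. ?c j (v j) w)"
      using i by (subst sum.remove[of _ i]) auto
    ultimately show "?c i (v i) w \<le> ?c i x w"
      using le[of "v(i := x)" w] by linarith
  qed
  show "(\<Sum>i=1..m. lam *\<^sub>R (w - v i)) = 0"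
  proof (rule GDERIV_minimum)
    have "((\<lambda>w. \<Sum>i=1..m. lam / 2 * (norm (v i - w))\<^sup>2) has_derivative
        (\<lambda>h. \<Sum>i=1..m. inner h (lam *\<^sub>R (w - v i)))) (at w)"
      by (intro has_derivative_sum GDERIV_prox_term[unfolded gderiv_def])
    then show "GDERIV (\<lambda>w. \<Sum>i=1..m. lam / 2 * (norm (v i - w))\<^sup>2) w :> (\<Sum>i=1..m. lam *\<^sub>R (w - v i))"
      by (simp add: gderiv_def inner_sum_right)
    fix y
    show "(\<Sum>i=1..m. lam / 2 * (norm (v i - w))\<^sup>2) \<le> (\<Sum>i=1..m. lam / 2 * (norm (v i - y))\<^sup>2)"
      using le[of v y] by (simp add: client_objective_def sum.distrib norm_minus_commute)
  qed
qed

section \<open>Error reduction in one communication round\<close>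

lemma pinched_resolvent_unique:
  assumes g: "pinched \<mu> L g" and "0 < \<mu>" "0 < lam"
    and "g p + lam *\<^sub>R (p - w) = 0" "g q + lam *\<^sub>R (q - w) = 0"
  shows "p = q"
proof -
  have "(\<mu> + lam) * norm (p - q) \<le> 0"
    using pinched_expansion[OF pinched_shift[OF g, of lam w], of p q] assms(4,5) by simp
  with assms(2,3) show ?thesis by (simp add: mult_le_0_iff)
qed

text \<open>The proximal point \<open>p\<close> is a fixed point of the local step, so every step
  contracts the distance to it.\<close>

lemma local_steps_contract:
  assumes g: "pinched \<mu> L g" and pos: "0 < \<mu>" "\<mu> \<le> L" "0 < lam"
    and p: "g p + lam *\<^sub>R (p - w) = 0"
    and step: "\<And>k. k < K \<Longrightarrow> x (k + 1) = x k - step_local lam L *\<^sub>R (g (x k) + lam *\<^sub>R (x k - w))"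
  shows "norm (x K - p) \<le> (1 - step_local lam L * mu_l lam \<mu>) ^ K * norm (x 0 - p)"
proof -
  let ?\<rho> = "1 - step_local lam L * mu_l lam \<mu>"
  have \<rho>: "0 \<le> ?\<rho>" using pos by (simp add: step_local_def mu_l_def field_simps)
  have "k \<le> K \<Longrightarrow> norm (x k - p) \<le> ?\<rho> ^ k * norm (x 0 - p)" for k
  proof (induction k)
    case (Suc k)
    have "norm (x (Suc k) - p)
        = norm ((x k - step_local lam L *\<^sub>R (g (x k) + lam *\<^sub>R (x k - w)))
          - (p - step_local lam L *\<^sub>R (g p + lam *\<^sub>R (p - w))))"
      using step[of k] Suc.prems p by simp
    also have "\<dots> \<le> (1 - step_local lam L * (\<mu> + lam)) * norm (x k - p)"
      using pos by (intro pinched_gradient_step[OF pinched_shift[OF g]])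
        (auto simp: step_local_def field_simps)
    also have "\<dots> \<le> ?\<rho> * (?\<rho> ^ k * norm (x 0 - p))"
      using Suc \<rho> by (auto simp: mu_l_def intro!: mult_left_mono)
    finally show ?case by simp
  qed simp
  then show ?thesis by blast
qed

lemma step_global_L_g:
  assumes "0 < lam" "0 < L"
  shows "step_global lam L * L_g lam L = 1 / 2"
proof -
  have "lam + L \<noteq> 0" using assms by simp
  with assms show ?thesis by (simp add: step_global_def L_g_def)
qed

lemma step_global_mu_g_le:
  assumes "0 < \<mu>" "\<mu> \<le> L" "0 < lam"
  shows "step_global lam L * mu_g lam \<mu> \<le> 1 / 2"
proof -
  have "mu_g lam \<mu> \<le> L_g lam L"
    using assms by (simp add: mu_g_def L_g_def field_simps)
  then have "step_global lam L * mu_g lam \<mu> \<le> step_global lam L * L_g lam L"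
    using assms by (intro mult_left_mono) (auto simp: step_global_def)
  then show ?thesis using step_global_L_g[of lam L] assms by simp
qed

text \<open>The product of \<open>L_w\<close>, \<open>1 / mu_g\<close> and \<open>lam\<close>
  collapses to \<open>lam / \<mu>\<close>, and the right-hand side is \<open>(1 / 2) ^ 4\<close>;
  multiplying by 16 gives the constants 32 and 1024.\<close>

lemma admissible_K_iff:
  assumes pos: "0 < \<mu>" "\<mu> \<le> L" "0 < lam"
  shows "admissible_K lam \<mu> L K \<longleftrightarrow>
    (32 + 1024 * (lam / \<mu>)\<^sup>2) * ((L - \<mu>) / (lam + L)) ^ K \<le> 1"
proof -
  have "L_w lam \<mu> * (1 / mu_g lam \<mu>) * lam = lam / \<mu>"
    using pos by (simp add: L_w_def mu_g_def add_pos_pos)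
  then have "(L_w lam \<mu>)\<^sup>2 * (1 / mu_g lam \<mu>)\<^sup>2 * lam\<^sup>2 = (lam / \<mu>)\<^sup>2"
    by (simp only: power_mult_distrib[symmetric])
  then have 1: "64 * (L_w lam \<mu>)\<^sup>2 * (1 / mu_g lam \<mu>)\<^sup>2 * lam\<^sup>2 = 64 * (lam / \<mu>)\<^sup>2"
    by (simp only: mult.assoc)
  have 2: "1 - step_global lam L * L_g lam L = 1 / 2"
    using step_global_L_g[of lam L] pos by simp
  have 3: "1 - step_local lam L * mu_l lam \<mu> = (L - \<mu>) / (lam + L)"
    using pos by (simp add: step_local_def mu_l_def field_simps)
  show ?thesis
    unfolding admissible_K_def 1 2 3 by (simp add: power_divide algebra_simps)
qed

lemma admissible_K_bounds:
  assumes adm: "admissible_K lam \<mu> L K" and pos: "0 < \<mu>" "\<mu> \<le> L" "0 < lam"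
  defines "R \<equiv> (1 - step_local lam L * mu_l lam \<mu>) ^ K"
  shows "0 \<le> R" "R \<le> 1 / 32" "lam * R \<le> \<mu> / 256"
proof -
  let ?x = "lam / \<mu>"
  have Rq: "R = ((L - \<mu>) / (lam + L)) ^ K"
    using pos by (simp add: R_def step_local_def mu_l_def field_simps)
  then show R: "0 \<le> R" using pos by simp
  have *: "(32 + 1024 * ?x\<^sup>2) * R \<le> 1"
    using adm unfolding admissible_K_iff[OF pos] Rq .
  have "32 * R \<le> (32 + 1024 * ?x\<^sup>2) * R"
    using R by (intro mult_right_mono) auto
  with * show "R \<le> 1 / 32" by simp
  \<comment> \<open>This is 16 times \<open>(8 * ?x - 1)\<^sup>2 \<ge> 0\<close>, with room to
    spare.\<close>
  have "256 * ?x \<le> 32 + 1024 * ?x\<^sup>2"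
    using zero_le_power2[of "8 * ?x - 1"] by (simp only: power2_diff power_mult_distrib) simp
  then have "256 * ?x * R \<le> (32 + 1024 * ?x\<^sup>2) * R"
    using R by (rule mult_right_mono)
  with * have "256 * ?x * R \<le> 1" by linarith
  then show "lam * R \<le> \<mu> / 256" using pos by (simp add: field_simps)
qed

text \<open>Write \<open>s\<close> for \<open>\<gamma> * mu_g lam \<mu>\<close>. The weight 4 makes
  the term \<open>\<gamma> * lam * d\<close> in \<open>e'\<close> a quarter of the weighted
  \<open>d\<close>, so the weighted \<open>d'\<close> may use the remaining
  \<open>3 / 4 - s / 3\<close>. The feedback of \<open>e\<close> into \<open>d'\<close> costs at
  most two thirds of the gain \<open>s\<close>, which leaves \<open>1 - s / 3\<close>.\<close>

lemma potential_contraction: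
  fixes e d e' d' R :: real
  assumes pos: "0 < \<mu>" "\<mu> \<le> L" "0 < lam" and R: "0 \<le> R" "R \<le> 1 / 32" "lam * R \<le> \<mu> / 256"
    and ed: "0 \<le> e" "0 \<le> d"
  defines "\<gamma> \<equiv> step_global lam L"
  assumes e': "e' \<le> (1 - \<gamma> * mu_g lam \<mu>) * e + \<gamma> * lam * d"
    and d': "d' \<le> R * (d + L_w lam \<mu> * (e / 2 + \<gamma> * lam * d))"
  shows "e' + 4 * \<gamma> * lam * d' \<le> (1 - \<gamma> * mu_g lam \<mu> / 3) * (e + 4 * \<gamma> * lam * d)"
proof -
  let ?s = "\<gamma> * mu_g lam \<mu>"
  have \<gamma>: "0 < \<gamma>" using pos by (simp add: \<gamma>_def step_global_def)
  have s: "?s \<le> 1 / 2" unfolding \<gamma>_def by (rule step_global_mu_g_le[OF pos])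
  have "lam * (L_w lam \<mu> * R) \<le> mu_g lam \<mu> / 256"
    using mult_left_mono[OF R(3), of "lam / (lam + \<mu>)"] pos
    by (simp add: L_w_def mu_g_def field_simps)
  then have "2 * \<gamma> * (lam * (L_w lam \<mu> * R)) \<le> 2 * \<gamma> * (mu_g lam \<mu> / 256)"
    using \<gamma> by (intro mult_left_mono) auto
  also have "\<dots> \<le> 2 / 3 * ?s"
    using \<gamma> pos by (simp add: mu_g_def field_simps)
  finally have "2 * \<gamma> * lam * L_w lam \<mu> * R * e \<le> 2 / 3 * ?s * e"
    using ed by (intro mult_right_mono) (simp_all add: mult_ac)
  \<comment> \<open>The product \<open>L_w lam \<mu> * \<gamma> * lam\<close> can grow with
    \<open>lam\<close>, but no faster than \<open>lam / \<mu> / 2 + 1 / 2\<close>; the bound on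
    \<open>lam * R\<close> absorbs this growth.\<close>
  moreover have "R * (1 + L_w lam \<mu> * \<gamma> * lam) \<le> 1 / 2"
  proof -
    have "lam / q * ((lam + L) / (2 * lam * L)) * lam = lam * (lam / L) / (2 * q) + lam / (2 * q)"
      if "q > 0" for q :: real
      using pos that by (simp add: field_simps)
    then have "L_w lam \<mu> * \<gamma> * lam = lam * (lam / L) / (2 * (lam + \<mu>)) + lam / (2 * (lam + \<mu>))"
      using pos by (simp add: L_w_def \<gamma>_def step_global_def)
    also have "lam * (lam / L) / (2 * (lam + \<mu>)) \<le> lam / \<mu> / 2"
    proof -
      have "lam / L \<le> lam / \<mu>" using pos by (intro divide_left_mono) auto
      moreover have "lam / (lam + \<mu>) \<le> 1" using pos by simp
      ultimately have le: "lam / (lam + \<mu>) * (lam / L) \<le> 1 * (lam / \<mu>)"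
        using pos by (intro mult_mono) auto
      have half: "lam * (lam / L) / (2 * q) = lam / q * (lam / L) / 2" for q by simp
      show ?thesis unfolding half using le by (intro divide_right_mono) simp_all
    qed
    also have "lam / (2 * (lam + \<mu>)) \<le> 1 / 2" using pos by simp
    finally have "L_w lam \<mu> * \<gamma> * lam \<le> lam / \<mu> / 2 + 1 / 2" by simp
    then have "R * (1 + L_w lam \<mu> * \<gamma> * lam) \<le> R * (1 + (lam / \<mu> / 2 + 1 / 2))"
      using R(1) by (intro mult_left_mono) auto
    also have "\<dots> = 3 / 2 * R + (lam * R) / \<mu> / 2" by (simp add: field_simps)
    also have "(lam * R) / \<mu> \<le> 1 / 256" using R(3) pos by (simp add: field_simps)
    finally show ?thesis using R(2) by simp
  qed
  then have "R * (1 + L_w lam \<mu> * \<gamma> * lam) \<le> 3 / 4 - ?s / 3" using s by simp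
  then have "4 * \<gamma> * lam * d * (R * (1 + L_w lam \<mu> * \<gamma> * lam)) \<le> 4 * \<gamma> * lam * d * (3 / 4 - ?s / 3)"
    using \<gamma> pos ed by (intro mult_left_mono) auto
  moreover have "4 * \<gamma> * lam * d' \<le> 4 * \<gamma> * lam * (R * (d + L_w lam \<mu> * (e / 2 + \<gamma> * lam * d)))"
    using \<gamma> pos d' by (intro mult_left_mono) auto
  moreover have "4 * \<gamma> * lam * (R * (d + L_w lam \<mu> * (e / 2 + \<gamma> * lam * d)))
      = 2 * \<gamma> * lam * L_w lam \<mu> * R * e + 4 * \<gamma> * lam * d * (R * (1 + L_w lam \<mu> * \<gamma> * lam))"
    by (simp add: algebra_simps)
  ultimately have "e' + 4 * \<gamma> * lam * d' \<le> (1 - ?s) * e + \<gamma> * lam * d + 2 / 3 * ?s * e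
      + 4 * \<gamma> * lam * d * (3 / 4 - ?s / 3)"
    using e' by linarith
  also have "\<dots> = (1 - ?s / 3) * (e + 4 * \<gamma> * lam * d)"
    by (simp add: algebra_simps)
  finally show ?thesis .
qed

section \<open>The error along a run\<close>

text \<open>The local models are tracked at the end of a round, where the global update reads them;
  the next round starts from these same values.\<close>

lemma fed_gd_run_bound:
  fixes l :: "'a::euclidean_space \<Rightarrow> 'z \<Rightarrow> real"
  assumes fl: "fl_problem l m n z lam \<mu> L" and adm: "admissible_K lam \<mu> L K"
    and run: "fed_gd_run l m n z lam (step_local lam L) (step_global lam L) K wg wl"
    and min: "fl_minimizer l m n z lam w v"
  defines "\<sigma> \<equiv> 1 - step_global lam L * mu_g lam \<mu> / 3"
  shows "\<exists>V\<ge>0. \<forall>t\<ge>1. norm (wg t - w) \<le> V * \<sigma> ^ (t - 1)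
    \<and> (\<forall>i\<in>{1..m}. norm (wl t K i - v i) \<le> V * \<sigma> ^ (t - 1))"
proof -
  note pos = fl_problem_pos(2,3,1)[OF fl]
  have m: "real m > 0" using fl_problem_pos(4)[OF fl] by simp
  let ?g = "\<lambda>i. grad (client_loss l n z i)"
  let ?\<gamma> = "step_global lam L" and ?R = "(1 - step_local lam L * mu_l lam \<mu>) ^ K"
  have \<gamma>: "0 < ?\<gamma>" using pos by (simp add: step_global_def)
  have s: "?\<gamma> * mu_g lam \<mu> \<le> 1 / 2" by (rule step_global_mu_g_le[OF pos])
  have \<gamma>L: "?\<gamma> * L_g lam L = 1 / 2" using pos by (intro step_global_L_g) auto
  have Lw: "0 \<le> L_w lam \<mu>" "L_w lam \<mu> \<le> 1" using pos by (auto simp: L_w_def)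
  note R = admissible_K_bounds[OF adm pos]
  note g = fl_problem_pinched[OF fl]
  \<comment> \<open>\<open>P i\<close> is the proximal map of client \<open>i\<close>; stationarity
    identifies its value at the optimum \<open>w\<close> with \<open>v i\<close>.\<close>
  have "\<forall>i\<in>{1..m}. \<exists>P. \<forall>w. ?g i (P w) + lam *\<^sub>R (P w - w) = 0"
    using pinched_resolvent_exists[OF g pos] by metis
  then obtain P where P: "?g i (P i w) + lam *\<^sub>R (P i w - w) = 0" if "i \<in> {1..m}" for i w
    by metis
  have Pw: "P i w = v i" if "i \<in> {1..m}" for i
    by (rule pinched_resolvent_unique[OF g[OF that] pos(1,3) P[OF that]
          fl_minimizer_stationary(1)[OF fl min that]])
  have Plip: "norm (P i x - P i y) \<le> L_w lam \<mu> * norm (x - y)" if "i \<in> {1..m}" for i x y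
    by (rule pinched_resolvent_lipschitz[OF g[OF that] pos(3,1) P[OF that]])
  \<comment> \<open>\<open>G\<close> is the gradient of the averaged Moreau envelope, and
    \<open>w\<close> is a zero of it.\<close>
  define G where "G x = (1 / real m) *\<^sub>R (\<Sum>i=1..m. lam *\<^sub>R (x - P i x))" for x
  have G: "pinched (mu_g lam \<mu>) (L_g lam L) G"
    unfolding G_def
    using pinched_mean[of "{1..m}" "mu_g lam \<mu>" "L_g lam L" "\<lambda>i x. lam *\<^sub>R (x - P i x)"] m
      pinched_envelope[OF g pos P] by fastforce
  have Gw: "G w = 0"
    using fl_minimizer_stationary(2)[OF fl min] by (simp add: G_def Pw)
  have gsum: "0 \<le> mu_g lam \<mu> + L_g lam L" using pos by (simp add: mu_g_def L_g_def)
  have step2: "?\<gamma> * (mu_g lam \<mu> + L_g lam L) \<le> 2"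
    using s \<gamma>L by (simp add: distrib_left)

  define e where "e t = norm (wg t - w)" for t
  define d where "d t = (\<Sum>i=1..m. norm (wl t K i - P i (wg t))) / real m" for t
  \<comment> \<open>\<open>r t\<close> is the error of the global gradient step caused by using
    \<open>wl t K i\<close> in place of the exact proximal points.\<close>
  define r where "r t = (?\<gamma> * lam / real m) *\<^sub>R (\<Sum>i=1..m. wl t K i - P i (wg t))" for t
  have e0: "0 \<le> e t" and d0: "0 \<le> d t" for t by (auto simp: e_def d_def sum_nonneg)
  have r: "norm (r t) \<le> ?\<gamma> * lam * d t" for t
  proof -
    have "norm (r t) = ?\<gamma> * lam / real m * norm (\<Sum>i=1..m. wl t K i - P i (wg t))"
      using \<gamma> pos by (simp add: r_def)
    also have "\<dots> \<le> ?\<gamma> * lam / real m * (\<Sum>i=1..m. norm (wl t K i - P i (wg t)))"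
      using \<gamma> pos by (intro mult_left_mono norm_sum) auto
    finally show ?thesis by (simp add: d_def)
  qed
  have wg: "wg (t + 1) = wg t - ?\<gamma> *\<^sub>R G (wg t) + r t" if "t \<ge> 1" for t
  proof -
    have "(\<Sum>i=1..m. lam *\<^sub>R (wg t - wl t K i))
        = (\<Sum>i=1..m. lam *\<^sub>R (wg t - P i (wg t))) - lam *\<^sub>R (\<Sum>i=1..m. wl t K i - P i (wg t))"
      by (simp add: scaleR_right.sum scaleR_right_diff_distrib flip: sum_subtractf)
    moreover have "wg (t + 1) = wg t - (?\<gamma> / real m) *\<^sub>R (\<Sum>i=1..m. lam *\<^sub>R (wg t - wl t K i))"
      using run that by (simp add: fed_gd_run_def)
    ultimately show ?thesis
      by (simp add: G_def r_def scaleR_right_diff_distrib)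
  qed
  have e_step: "e (t + 1) \<le> (1 - ?\<gamma> * mu_g lam \<mu>) * e t + ?\<gamma> * lam * d t" if "t \<ge> 1" for t
  proof -
    have "wg (t + 1) - w = ((wg t - ?\<gamma> *\<^sub>R G (wg t)) - (w - ?\<gamma> *\<^sub>R G w)) + r t"
      using wg[OF that] Gw by simp
    moreover have "norm ((wg t - ?\<gamma> *\<^sub>R G (wg t)) - (w - ?\<gamma> *\<^sub>R G w))
        \<le> (1 - ?\<gamma> * mu_g lam \<mu>) * norm (wg t - w)"
      using \<gamma> step2 by (intro pinched_gradient_step[OF G]) auto
    ultimately show ?thesis
      unfolding e_def using norm_triangle_mono r by metis
  qed
  have drift: "norm (wg (t + 1) - wg t) \<le> e t / 2 + ?\<gamma> * lam * d t" if "t \<ge> 1" for t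
  proof -
    have "norm (wg (t + 1) - wg t) = norm (r t - ?\<gamma> *\<^sub>R (G (wg t) - G w))"
      unfolding wg[OF that] Gw by simp
    also have "\<dots> \<le> norm (r t) + ?\<gamma> * norm (G (wg t) - G w)"
      using norm_triangle_ineq4[of "r t" "?\<gamma> *\<^sub>R (G (wg t) - G w)"] \<gamma> by simp
    also have "\<dots> \<le> ?\<gamma> * lam * d t + ?\<gamma> * (L_g lam L * norm (wg t - w))"
      using \<gamma> r pinched_lipschitz[OF G gsum] by (intro add_mono mult_left_mono) auto
    also have "?\<gamma> * (L_g lam L * norm (wg t - w)) = e t / 2"
      using \<gamma>L by (simp add: e_def flip: mult.assoc)
    finally show ?thesis by simp
  qed
  \<comment> \<open>Warm start: the local steps begin at the old local model, whose distance to the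
    new proximal point exceeds the old distance by at most the movement of that point. The latter is
    controlled by \<open>drift\<close>.\<close>
  have d_step: "d (t + 1) \<le> ?R * (d t + L_w lam \<mu> * (e t / 2 + ?\<gamma> * lam * d t))" if t: "t \<ge> 1" for t
  proof -
    let ?\<delta> = "L_w lam \<mu> * (e t / 2 + ?\<gamma> * lam * d t)"
    have "norm (wl (t + 1) K i - P i (wg (t + 1))) \<le> ?R * (norm (wl t K i - P i (wg t)) + ?\<delta>)"
      if i: "i \<in> {1..m}" for i
    proof -
      have run': "wl (t + 1) 0 i = wl t K i"
        "\<And>k. k < K \<Longrightarrow> wl (t + 1) (k + 1) i = wl (t + 1) k i - step_local lam L *\<^sub>R
          (?g i (wl (t + 1) k i) + lam *\<^sub>R (wl (t + 1) k i - wg (t + 1)))"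
        using run i by (auto simp: fed_gd_run_def)
      have "norm (wl (t + 1) K i - P i (wg (t + 1))) \<le> ?R * norm (wl t K i - P i (wg (t + 1)))"
        using local_steps_contract[OF g[OF i] pos P[OF i], of K "\<lambda>k. wl (t + 1) k i", OF run'(2)]
        unfolding run'(1) .
      also have "norm (wl t K i - P i (wg (t + 1)))
          \<le> norm (wl t K i - P i (wg t)) + norm (P i (wg (t + 1)) - P i (wg t))"
        by (metis diff_diff_eq2 diff_add_cancel norm_triangle_ineq4 add_diff_cancel_right')
      also have "norm (P i (wg (t + 1)) - P i (wg t)) \<le> ?\<delta>"
        using Plip[OF i, of "wg (t + 1)" "wg t"] mult_left_mono[OF drift[OF t] Lw(1)] by linarith
      finally show ?thesis using R(1) by (simp add: mult_left_mono)
    qed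
    then have "d (t + 1) \<le> (\<Sum>i=1..m. ?R * (norm (wl t K i - P i (wg t)) + ?\<delta>)) / real m"
      unfolding d_def using m by (intro divide_right_mono sum_mono) auto
    also have "\<dots> = ?R * (d t + ?\<delta>)"
      unfolding sum_distrib_left[symmetric] sum.distrib d_def using m by (simp add: field_simps)
    finally show ?thesis .
  qed

  define V where "V t = e t + 4 * ?\<gamma> * lam * d t" for t
  have V_step: "V (t + 1) \<le> \<sigma> * V t" if "t \<ge> 1" for t
    unfolding V_def \<sigma>_def
    by (rule potential_contraction[OF pos R e0 d0 e_step[OF that] d_step[OF that]])
  have \<sigma>: "0 \<le> \<sigma>" using s by (simp add: \<sigma>_def)
  have V: "V t \<le> V 1 * \<sigma> ^ (t - 1)" if "t \<ge> 1" for t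
    using that
  proof (induction t rule: dec_induct)
    case (step t)
    have "V (Suc t) \<le> \<sigma> * (V 1 * \<sigma> ^ (t - 1))"
      using V_step[OF step(1)] mult_left_mono[OF step(3) \<sigma>] by simp
    then show ?case using step(1) by (cases t) (auto simp: mult_ac)
  qed simp
  \<comment> \<open>A single client's distance is at most \<open>m\<close> times the mean
    \<open>d t\<close>, and \<open>d t\<close> enters \<open>V t\<close> with weight
    \<open>4 * ?\<gamma> * lam\<close>; the summand 1 pays for \<open>e t\<close>.\<close>
  let ?C = "1 + real m / (4 * ?\<gamma> * lam)"
  have V0: "0 \<le> V t" for t using e0 d0 \<gamma> pos by (simp add: V_def)
  have C: "0 \<le> real m / (4 * ?\<gamma> * lam)" using \<gamma> pos by simp
  have eV: "e t \<le> V t" for t using d0[of t] \<gamma> pos by (simp add: V_def)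
  have loc: "norm (wl t K i - v i) \<le> ?C * V t" if i: "i \<in> {1..m}" for t i
  proof -
    have "norm (wl t K i - v i) \<le> norm (wl t K i - P i (wg t)) + norm (P i (wg t) - P i w)"
      unfolding Pw[OF i] by (metis diff_add_cancel add_diff_eq norm_triangle_ineq)
    also have "norm (wl t K i - P i (wg t)) \<le> (\<Sum>i=1..m. norm (wl t K i - P i (wg t)))"
      using i by (intro member_le_sum) auto
    also have "\<dots> = real m * d t" using m by (simp add: d_def)
    also have "\<dots> = real m / (4 * ?\<gamma> * lam) * (4 * ?\<gamma> * lam * d t)" using \<gamma> pos by simp
    also have "\<dots> \<le> real m / (4 * ?\<gamma> * lam) * V t"
      using e0 C by (intro mult_left_mono) (auto simp: V_def)
    also have "norm (P i (wg t) - P i w) \<le> 1 * e t"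
      unfolding e_def using Plip[OF i] Lw(2) by (meson mult_right_mono norm_ge_zero order_trans)
    finally show ?thesis using eV[of t] by (simp add: algebra_simps)
  qed
  show ?thesis
  proof (intro exI[of _ "?C * V 1"] conjI allI impI ballI)
    show "0 \<le> ?C * V 1" using C V0 by simp
    fix t :: nat assume t: "1 \<le> t"
    have CV: "?C * V t \<le> ?C * V 1 * \<sigma> ^ (t - 1)"
      using mult_left_mono[OF V[OF t], of ?C] C by (simp add: mult.assoc)
    have "1 * V t \<le> ?C * V t" using C V0 by (intro mult_right_mono) auto
    then show "norm (wg t - w) \<le> ?C * V 1 * \<sigma> ^ (t - 1)"
      using CV eV[of t] by (simp add: e_def)
    fix i assume "i \<in> {1..m}"
    from loc[OF this, of t] CV show "norm (wl t K i - v i) \<le> ?C * V 1 * \<sigma> ^ (t - 1)" by linarith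
  qed
qed

section \<open>Linear rates and iteration counts\<close>

text \<open>The bound starts at 2 because \<open>wl t 0 i\<close> is the result of the previous
  round, and at \<open>t = 1\<close> it is an arbitrary initial value. The second summand of
  \<open>?C\<close> covers that value; the first converts the exponent \<open>t - 2\<close> to
  \<open>t\<close>.\<close>

lemma converges_linearlyI:
  fixes x :: "nat \<Rightarrow> 'a::real_normed_vector"
  assumes r: "0 < r" "r < 1" and \<sigma>: "0 \<le> \<sigma>" "\<sigma>\<^sup>2 \<le> r" and V: "0 \<le> V"
    and bound: "\<And>t. 2 \<le> t \<Longrightarrow> norm (x t - a) \<le> V * \<sigma> ^ (t - 2)"
  shows "converges_linearly x a r"
proof -
  let ?C = "V\<^sup>2 / r\<^sup>2 + (norm (x 1 - a))\<^sup>2 / r"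
  have "(norm (x t - a))\<^sup>2 \<le> ?C * r ^ t" if "t \<ge> 1" for t
  proof (cases "t = 1")
    case True
    then show ?thesis using r by (simp add: distrib_right)
  next
    case False
    with that obtain k where t: "t = k + 2" by (metis add.commute le_Suc_ex nat_less_le Suc_leI one_add_one plus_1_eq_Suc)
    have "(norm (x t - a))\<^sup>2 \<le> (V * \<sigma> ^ k)\<^sup>2"
      using bound[of t] t by (intro power_mono) auto
    also have "\<dots> = V\<^sup>2 * (\<sigma>\<^sup>2) ^ k" by (simp add: power_mult_distrib flip: power_mult) (simp add: mult.commute)
    also have "\<dots> \<le> V\<^sup>2 * r ^ k" using \<sigma> by (intro mult_left_mono power_mono) auto
    also have "\<dots> = V\<^sup>2 / r\<^sup>2 * r ^ t" using r by (simp add: t power_add power2_eq_square)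
    also have "\<dots> \<le> ?C * r ^ t" using r by (intro mult_right_mono) auto
    finally show ?thesis .
  qed
  with r show ?thesis unfolding converges_linearly_def by blast
qed

text \<open>\<open>C\<close> only limits how small \<open>\<epsilon>\<close> must be, so the factor
  9 is universal: driving the power below \<open>\<epsilon>\<^sup>2\<close> leaves a factor
  \<open>\<epsilon>\<close> to beat \<open>C\<close>.\<close>

lemma linear_rate_iteration_count:
  fixes Q C :: real
  assumes "1 \<le> Q"
  shows "\<forall>\<^sub>F \<epsilon> in at_right 0. \<exists>N\<ge>1. (\<forall>T\<ge>N. C * (1 - 1 / (4 * Q)) ^ T \<le> \<epsilon>)
    \<and> real N \<le> 9 * (Q * ln (1 / \<epsilon>))"
  unfolding eventually_at_right_field
\<comment> \<open>The first threshold makes \<open>ln (1 / \<epsilon>)\<close> at least 1, so that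
  rounding up costs at most one more multiple; the second gives
  \<open>\<bar>C\<bar> \<le> 1 / \<epsilon>\<close>.\<close>
proof (intro exI[of _ "min (exp (-1)) (1 / (\<bar>C\<bar> + 1))"] conjI allI impI)
  show "0 < min (exp (-1)) (1 / (\<bar>C\<bar> + 1))" by (simp add: add_nonneg_pos)
  fix \<epsilon> :: real assume \<epsilon>: "0 < \<epsilon>" "\<epsilon> < min (exp (-1)) (1 / (\<bar>C\<bar> + 1))"
  \<comment> \<open>The 8 is 4 from the rate times 2 from the target
    \<open>\<epsilon>\<^sup>2\<close>.\<close>
  let ?N = "nat \<lceil>8 * Q * ln (1 / \<epsilon>)\<rceil>"
  have "ln \<epsilon> < -1" using \<epsilon> by (metis exp_gt_zero ln_exp ln_less_cancel_iff min_less_iff_conj)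
  then have ln: "1 \<le> ln (1 / \<epsilon>)" using \<epsilon> by (simp add: ln_div)
  then have Qln: "1 \<le> Q * ln (1 / \<epsilon>)" using assms mult_mono[of 1 Q 1 "ln (1 / \<epsilon>)"] by simp
  have C: "\<bar>C\<bar> \<le> 1 / \<epsilon>" using \<epsilon> by (simp add: field_simps)
  have "C * (1 - 1 / (4 * Q)) ^ T \<le> \<epsilon>" if T: "?N \<le> T" for T
  proof -
    have "8 * Q * ln (1 / \<epsilon>) \<le> real T" using T by linarith
    then have "2 * ln (1 / \<epsilon>) \<le> real T * (1 / (4 * Q))" using assms by (simp add: field_simps)
    then have "- (real T * (1 / (4 * Q))) \<le> 2 * ln \<epsilon>" using \<epsilon> by (simp add: ln_div)
    have "(1 - 1 / (4 * Q)) ^ T \<le> exp (- (1 / (4 * Q))) ^ T"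
      using exp_ge_add_one_self[of "- (1 / (4 * Q))"] assms
      by (intro power_mono) (auto simp: field_simps)
    also have "\<dots> = exp (- (real T * (1 / (4 * Q))))"
      by (simp flip: exp_of_nat_mult)
    also have "\<dots> \<le> exp (2 * ln \<epsilon>)" by (subst exp_le_cancel_iff) fact
    also have "\<dots> = \<epsilon>\<^sup>2" using \<epsilon> by (simp add: exp_double)
    finally have "(1 - 1 / (4 * Q)) ^ T \<le> \<epsilon>\<^sup>2" .
    moreover have "0 \<le> (1 - 1 / (4 * Q)) ^ T" using assms by (simp add: field_simps)
    ultimately have "C * (1 - 1 / (4 * Q)) ^ T \<le> 1 / \<epsilon> * \<epsilon>\<^sup>2"
      using C \<epsilon> by (intro mult_mono) auto
    then show ?thesis using \<epsilon> by (simp add: power2_eq_square)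
  qed
  moreover have "1 \<le> ?N" using Qln by linarith
  moreover have "real ?N \<le> 9 * (Q * ln (1 / \<epsilon>))" using Qln by linarith
  ultimately show "\<exists>N\<ge>1. (\<forall>T\<ge>N. C * (1 - 1 / (4 * Q)) ^ T \<le> \<epsilon>) \<and> real N \<le> 9 * (Q * ln (1 / \<epsilon>))"
    by blast
qed

section \<open>Existence of an admissible number of local steps\<close>

text \<open>If \<open>\<lambda>/\<mu>\<close> is at most of order \<open>\<kappa>\<^sup>2\<close>, its logarithm is absorbed by that of \<open>\<kappa>\<close>.
  Otherwise the contraction factor \<open>(L - \<mu>)/(\<lambda> + L) \<le> \<kappa>\<mu>/\<lambda>\<close> is so small that four steps
  suffice.\<close>

lemma admissible_K_exists:
  assumes pos: "0 < \<mu>" "\<mu> \<le> L" "0 < lam"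
  shows "\<exists>K. admissible_K lam \<mu> L K \<and> K_order 25 1 lam \<mu> L K"
proof -
  let ?q = "(L - \<mu>) / (lam + L)" and ?\<beta> = "(lam + L) / (lam + \<mu>)"
  let ?x = "lam / \<mu>" and ?\<kappa> = "L / \<mu>"
  have \<kappa>: "1 \<le> ?\<kappa>" and x: "0 < ?x" and q: "0 \<le> ?q" and \<beta>: "1 \<le> ?\<beta>"
    using pos by auto
  have ln\<kappa>: "0 \<le> ln ?\<kappa>" using \<kappa> by (rule ln_ge_zero)
  have \<beta>ln: "1 \<le> (1 + ln ?\<kappa>) * ?\<beta>"
    using mult_mono[of 1 "1 + ln ?\<kappa>" 1 ?\<beta>] \<beta> ln\<kappa> by simp
  show ?thesis
  proof (cases "?x \<le> 100 * ?\<kappa>\<^sup>2")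
    case True
    let ?a = "32 + 1024 * ?x\<^sup>2"
    \<comment> \<open>Since \<open>?q = 1 - 1 / ?\<beta>\<close> is at most
      \<open>exp (- (1 / ?\<beta>))\<close>, this many steps push the power below
      \<open>1 / ?a\<close>.\<close>
    let ?K = "nat \<lceil>ln ?a * ?\<beta>\<rceil>"
    have a: "0 < ?a" by (simp add: add_pos_nonneg)
    have "?x\<^sup>2 \<le> (100 * ?\<kappa>\<^sup>2)\<^sup>2" using True x by (intro power_mono) auto
    then have "?x\<^sup>2 \<le> 10000 * ?\<kappa> ^ 4" by (simp only: power_mult_distrib) simp
    moreover have "1 \<le> ?\<kappa> ^ 4" using \<kappa> by (rule one_le_power)
    \<comment> \<open>A power of two above the true constant 10240032, so that its logarithm is at
      most 24.\<close>
    moreover have "32 + 1024 * y \<le> 2 ^ 24 * k" if "y \<le> 10000 * k" "1 \<le> k" for y k :: real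
      using that by simp
    ultimately have "?a \<le> 2 ^ 24 * ?\<kappa> ^ 4" by blast
    then have "ln ?a \<le> ln (2 ^ 24 * ?\<kappa> ^ 4)" using a by (intro ln_mono) linarith
    also have "\<dots> = 24 * ln 2 + 4 * ln ?\<kappa>"
      using pos ln_realpow[of "2::real" 24] by (simp add: ln_mult ln_realpow)
    also have "\<dots> \<le> 24 * (1 + ln ?\<kappa>)"
      using ln_le_minus_one[of "2::real"] ln\<kappa> by simp
    finally have lna: "ln ?a \<le> 24 * (1 + ln ?\<kappa>)" .
    have "0 \<le> ln ?a" by (rule ln_ge_zero) (simp add: add_increasing2)
    then have "0 \<le> ln ?a * ?\<beta>" using \<beta> by (rule mult_nonneg_nonneg[OF _ order_trans[OF zero_le_one]])
    then have K: "ln ?a * ?\<beta> \<le> real ?K" "real ?K \<le> ln ?a * ?\<beta> + 1" by linarith+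
    have "?q = 1 - 1 / ?\<beta>" using pos by (simp add: field_simps)
    also have "\<dots> \<le> exp (- (1 / ?\<beta>))" using exp_ge_add_one_self[of "- (1 / ?\<beta>)"] by linarith
    finally have "?q ^ ?K \<le> exp (- (1 / ?\<beta>)) ^ ?K" using q by (intro power_mono)
    also have "\<dots> = exp (- (real ?K / ?\<beta>))" by (simp flip: exp_of_nat_mult)
    also have "\<dots> \<le> exp (- ln ?a)"
    proof -
      have "ln ?a \<le> real ?K / ?\<beta>" using K(1) \<beta> by (subst pos_le_divide_eq) linarith+
      then show ?thesis by (subst exp_le_cancel_iff) linarith
    qed
    also have "\<dots> = 1 / ?a" using a by (simp only: exp_minus exp_ln inverse_eq_divide)
    finally have "?a * ?q ^ ?K \<le> ?a * (1 / ?a)" using a by (intro mult_left_mono) linarith+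
    then have "admissible_K lam \<mu> L ?K"
      unfolding admissible_K_iff[OF pos] using a by simp
    \<comment> \<open>The ceiling adds 1, absorbed by \<open>\<beta>ln\<close>; hence 24 +
      1.\<close>
    moreover have "real ?K \<le> 25 * ((1 + ln ?\<kappa>) * ?\<beta>)"
    proof -
      have "ln ?a * ?\<beta> \<le> 24 * (1 + ln ?\<kappa>) * ?\<beta>" using lna \<beta> by (intro mult_right_mono) linarith+
      then show ?thesis using K(2) \<beta>ln by linarith
    qed
    ultimately show ?thesis unfolding K_order_def power_one_right mult.assoc by blast
  next
    case False
    have split: "(k / y) ^ 4 = (k\<^sup>2 / y)\<^sup>2 / y\<^sup>2" for k y :: real
      by (simp add: power_divide flip: power_mult power_add)
    have "?\<kappa>\<^sup>2 / ?x \<le> 1 / 100" using False by (subst pos_divide_le_eq[OF x]) linarith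
    moreover have "0 \<le> ?\<kappa>\<^sup>2 / ?x" by (intro divide_nonneg_pos zero_le_power2 x)
    ultimately have "(?\<kappa>\<^sup>2 / ?x)\<^sup>2 \<le> (1 / 100)\<^sup>2" by (rule power_mono)
    note small = divide_right_mono[OF this zero_le_power2[of ?x]]
    \<comment> \<open>In the fourth power of \<open>?\<kappa> / ?x\<close>, two factors
      \<open>?\<kappa>\<^sup>2 / ?x\<close> are small and the remaining
      \<open>1 / ?x\<^sup>2\<close> cancels the growth of \<open>1024 * ?x\<^sup>2\<close>.\<close>
    have "?q \<le> L / lam" using pos by (intro frac_le) auto
    also have "\<dots> = ?\<kappa> / ?x" using pos by simp
    finally have "?q ^ 4 \<le> (?\<kappa> / ?x) ^ 4" using q by (intro power_mono)
    also have "\<dots> = (?\<kappa>\<^sup>2 / ?x)\<^sup>2 / ?x\<^sup>2" by (rule split)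
    also have "\<dots> \<le> (1 / 100)\<^sup>2 / ?x\<^sup>2" by (rule small)
    finally have "?q ^ 4 \<le> (1 / 100)\<^sup>2 / ?x\<^sup>2" .
    then have "(32 + 1024 * ?x\<^sup>2) * ?q ^ 4 \<le> (32 + 1024 * ?x\<^sup>2) * ((1 / 100)\<^sup>2 / ?x\<^sup>2)"
      by (intro mult_left_mono) auto
    also have "\<dots> = 32 / 10000 / ?x\<^sup>2 + 1024 / 10000"
    proof -
      have "(32 + 1024 * y) * ((1 / 100)\<^sup>2 / y) = 32 / 10000 / y + 1024 / 10000" if "0 < y" for y :: real
        using that by (simp add: field_simps power2_eq_square)
      from this[OF zero_less_power[OF x]] show ?thesis .
    qed
    also have "\<dots> \<le> 1"
    proof -
      have "1 \<le> ?x" using False one_le_power[OF \<kappa>, of 2] by linarith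
      then have "1 \<le> ?x\<^sup>2" by (rule one_le_power)
      then have "32 / 10000 / ?x\<^sup>2 \<le> 32 / 10000 / 1" by (intro divide_left_mono) auto
      then show ?thesis by simp
    qed
    finally have "admissible_K lam \<mu> L 4" unfolding admissible_K_iff[OF pos] .
    moreover have "K_order 25 1 lam \<mu> L 4"
      unfolding K_order_def power_one_right mult.assoc using \<beta>ln by linarith
    ultimately show ?thesis by blast
  qed
qed

section \<open>Convergence rate and complexity\<close>

lemma fed_gd_convergence:
  fixes l :: "'a::euclidean_space \<Rightarrow> 'z \<Rightarrow> real"
  assumes fl: "fl_problem l m n z lam \<mu> L" and adm: "admissible_K lam \<mu> L K"
    and run: "fed_gd_run l m n z lam (step_local lam L) (step_global lam L) K wg wl"
    and min: "fl_minimizer l m n z lam w v"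
  defines "r \<equiv> 1 - step_global lam L * mu_g lam \<mu> / 2"
  shows "converges_linearly wg w r"
    and "i \<in> {1..m} \<Longrightarrow> converges_linearly (\<lambda>t. wl t 0 i) (v i) r"
proof -
  note pos = fl_problem_pos(2,3,1)[OF fl]
  let ?s = "step_global lam L * mu_g lam \<mu>"
  let ?\<sigma> = "1 - ?s / 3"
  obtain V where V: "0 \<le> V"
    and glob: "\<And>t. t \<ge> 1 \<Longrightarrow> norm (wg t - w) \<le> V * ?\<sigma> ^ (t - 1)"
    and loc: "\<And>t i. t \<ge> 1 \<Longrightarrow> i \<in> {1..m} \<Longrightarrow> norm (wl t K i - v i) \<le> V * ?\<sigma> ^ (t - 1)"
    using fed_gd_run_bound[OF fl adm run min] by blast
  have s: "0 < ?s" "?s \<le> 1 / 2"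
    using step_global_mu_g_le[OF pos] pos by (auto simp: step_global_def mu_g_def)
  have r: "0 < r" "r < 1" and \<sigma>: "0 \<le> ?\<sigma>" "?\<sigma> \<le> 1" using s by (auto simp: r_def)
  \<comment> \<open>Squaring gives \<open>1 - 2 * ?s / 3 + ?s\<^sup>2 / 9\<close>, and
    \<open>?s \<le> 1 / 2\<close> bounds the last term by \<open>?s / 18\<close>.\<close>
  have "?s * ?s \<le> 1 / 2 * ?s" using s by (intro mult_right_mono) auto
  then have \<sigma>r: "?\<sigma>\<^sup>2 \<le> r" using s(1) by (simp add: r_def power2_eq_square algebra_simps)
  show "converges_linearly wg w r"
  proof (rule converges_linearlyI[OF r \<sigma>(1) \<sigma>r V])
    fix t :: nat assume "2 \<le> t"
    then have "norm (wg t - w) \<le> V * ?\<sigma> ^ (t - 1)" by (intro glob) simp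
    also have "\<dots> \<le> V * ?\<sigma> ^ (t - 2)"
      by (intro mult_left_mono[OF power_decreasing[OF _ \<sigma>] V] diff_le_mono2) simp
    finally show "norm (wg t - w) \<le> V * ?\<sigma> ^ (t - 2)" .
  qed
  show "converges_linearly (\<lambda>t. wl t 0 i) (v i) r" if i: "i \<in> {1..m}"
  proof (rule converges_linearlyI[OF r \<sigma>(1) \<sigma>r V])
    fix t :: nat assume t: "2 \<le> t"
    then have "wl t 0 i = wl (t - 1) K i" using run i by (simp add: fed_gd_run_def)
    moreover have "t - 1 - 1 = t - 2" by simp
    ultimately show "norm (wl t 0 i - v i) \<le> V * ?\<sigma> ^ (t - 2)"
      using loc[of "t - 1" i] i t by simp
  qed
qed

lemma eventually_eps_solution:
  assumes glob: "converges_linearly wg w (1 - 1 / (4 * Q))"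
    and loc: "\<And>i. i \<in> {1..m} \<Longrightarrow> converges_linearly (\<lambda>t. wl t 0 i) (v i) (1 - 1 / (4 * Q))"
    and Q: "1 \<le> Q"
  shows "\<forall>\<^sub>F \<epsilon> in at_right 0. \<exists>N\<ge>1. (\<forall>T\<ge>N. eps_solution m wg wl w v \<epsilon> T)
    \<and> real N \<le> 9 * (Q * ln (1 / \<epsilon>))"
proof -
  let ?r = "1 - 1 / (4 * Q)"
  have r: "0 \<le> ?r ^ t" for t using Q by (simp add: field_simps)
  obtain C where C: "\<And>t. t \<ge> 1 \<Longrightarrow> (norm (wg t - w))\<^sup>2 \<le> C * ?r ^ t"
    using glob unfolding converges_linearly_def by blast
  have "\<forall>i\<in>{1..m}. \<exists>D. \<forall>t\<ge>1. (norm (wl t 0 i - v i))\<^sup>2 \<le> D * ?r ^ t"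
    using loc unfolding converges_linearly_def by blast
  then obtain D where D: "\<And>i t. i \<in> {1..m} \<Longrightarrow> t \<ge> 1 \<Longrightarrow> (norm (wl t 0 i - v i))\<^sup>2 \<le> D i * ?r ^ t"
    by metis
  \<comment> \<open>One constant dominates those of the global model and all clients, so a single
    \<open>N\<close> serves them together.\<close>
  let ?B = "\<bar>C\<bar> + (\<Sum>i=1..m. \<bar>D i\<bar>)"
  have "0 \<le> (\<Sum>i=1..m. \<bar>D i\<bar>)" by (intro sum_nonneg) auto
  then have CB: "C \<le> ?B" by linarith
  have DB: "D i \<le> ?B" if "i \<in> {1..m}" for i
    using member_le_sum[of i "{1..m}" "\<lambda>i. \<bar>D i\<bar>"] that by fastforce
  show ?thesis
    using linear_rate_iteration_count[OF Q, of ?B]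
  proof eventually_elim
    case (elim \<epsilon>)
    then obtain N where N: "N \<ge> 1" "\<And>T. T \<ge> N \<Longrightarrow> ?B * ?r ^ T \<le> \<epsilon>" "real N \<le> 9 * (Q * ln (1 / \<epsilon>))"
      by blast
    have "eps_solution m wg wl w v \<epsilon> T" if "T \<ge> N" for T
      unfolding eps_solution_def
    proof (intro conjI ballI)
      have T: "T \<ge> 1" using that N(1) by simp
      show "(norm (wg T - w))\<^sup>2 \<le> \<epsilon>"
        using C[OF T] mult_right_mono[OF CB r, of T] N(2)[OF that] by linarith
      show "(norm (wl T 0 i - v i))\<^sup>2 \<le> \<epsilon>" if i: "i \<in> {1..m}" for i
        using D[OF i T] mult_right_mono[OF DB[OF i] r, of T] N(2)[OF \<open>T \<ge> N\<close>] by linarith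
    qed
    with N show ?case by blast
  qed
qed

text \<open>With \<open>?Q\<close> the rate is \<open>1 - 1 / (4 * ?Q)\<close>, so the rounds scale
  with \<open>?Q\<close>. The bound on \<open>K\<close> contains the reciprocal of the ratio in
  \<open>?Q\<close>, and the product of both leaves \<open>\<kappa>\<close>.\<close>

lemma fed_gd_complexity:
  fixes l :: "'a::euclidean_space \<Rightarrow> 'z \<Rightarrow> real"
  assumes fl: "fl_problem l m n z lam \<mu> L" and \<kappa>: "\<kappa> = L / \<mu>"
    and adm: "admissible_K lam \<mu> L K" and ord: "K_order A p lam \<mu> L K"
    and run: "fed_gd_run l m n z lam (step_local lam L) (step_global lam L) K wg wl"
    and min: "fl_minimizer l m n z lam w v"
  shows "converges_linearly wg w (1 - (lam + L) / (4 * \<kappa> * (lam + \<mu>))) \<and>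
    (\<forall>i\<in>{1..m}. converges_linearly (\<lambda>t. wl t 0 i) (v i)
        (1 - (lam + L) / (4 * \<kappa> * (lam + \<mu>)))) \<and>
    (\<forall>\<^sub>F \<epsilon> in at_right 0. \<exists>N\<ge>1.
        (\<forall>T\<ge>N. eps_solution m wg wl w v \<epsilon> T) \<and>
        real N \<le> 9 * (\<kappa> * ((lam + \<mu>) / (lam + L)) * ln (1 / \<epsilon>)) \<and>
        real (K * N) \<le> 9 * A * (1 + ln \<kappa>) ^ p * (\<kappa> * ln (1 / \<epsilon>)))"
proof -
  note pos = fl_problem_pos(2,3,1)[OF fl]
  let ?Q = "\<kappa> * ((lam + \<mu>) / (lam + L))" and ?r = "1 - (lam + L) / (4 * \<kappa> * (lam + \<mu>))"
  have sums: "0 < lam + L" "0 < lam + \<mu>" "0 < L" using pos by auto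
  have r: "1 - step_global lam L * mu_g lam \<mu> / 2 = ?r"
    using pos sums by (simp add: \<kappa> step_global_def mu_g_def)
  have rQ: "?r = 1 - 1 / (4 * ?Q)" by simp
  have "L / \<mu> * (lam + \<mu>) = lam * (L / \<mu>) + L" using pos by (simp add: field_simps)
  moreover have "lam * 1 \<le> lam * (L / \<mu>)" using pos by (intro mult_left_mono) auto
  ultimately have Q: "1 \<le> ?Q" using sums by (simp add: \<kappa>)
  note conv = fed_gd_convergence[OF fl adm run min, unfolded r]
  note conv' = conv[unfolded rQ]
  have "\<forall>\<^sub>F \<epsilon> in at_right 0. \<exists>N\<ge>1.
        (\<forall>T\<ge>N. eps_solution m wg wl w v \<epsilon> T) \<and> real N \<le> 9 * (?Q * ln (1 / \<epsilon>)) \<and>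
        real (K * N) \<le> 9 * A * (1 + ln \<kappa>) ^ p * (\<kappa> * ln (1 / \<epsilon>))"
    using eventually_eps_solution[where wl = wl and v = v and m = m, OF conv' Q]
  proof (rule eventually_mono)
    fix \<epsilon> assume "\<exists>N\<ge>1. (\<forall>T\<ge>N. eps_solution m wg wl w v \<epsilon> T) \<and> real N \<le> 9 * (?Q * ln (1 / \<epsilon>))"
    then obtain N where N: "N \<ge> 1" "\<forall>T\<ge>N. eps_solution m wg wl w v \<epsilon> T" "real N \<le> 9 * (?Q * ln (1 / \<epsilon>))"
      by blast
    let ?a = "A * (1 + ln \<kappa>) ^ p * ((lam + L) / (lam + \<mu>))"
    have K: "real K \<le> ?a" using ord by (simp add: K_order_def \<kappa>)
    have "real (K * N) = real K * real N" by simp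
    also have "\<dots> \<le> ?a * (9 * (?Q * ln (1 / \<epsilon>)))"
      using K N(3) by (intro mult_mono) (auto intro: order_trans[OF _ K])
    also have "\<dots> = 9 * A * (1 + ln \<kappa>) ^ p * (\<kappa> * ln (1 / \<epsilon>))
        * ((lam + L) / (lam + \<mu>) * ((lam + \<mu>) / (lam + L)))"
      by (simp only: mult_ac)
    also have "(lam + L) / (lam + \<mu>) * ((lam + \<mu>) / (lam + L)) = 1" using sums by simp
    finally show "\<exists>N\<ge>1. (\<forall>T\<ge>N. eps_solution m wg wl w v \<epsilon> T) \<and> real N \<le> 9 * (?Q * ln (1 / \<epsilon>)) \<and>
        real (K * N) \<le> 9 * A * (1 + ln \<kappa>) ^ p * (\<kappa> * ln (1 / \<epsilon>))"
      using N by (intro exI[of _ N]) simp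
  qed
  with conv show ?thesis by blast
qed

theorem corollary2:
  shows
    "(\<exists>A>0. \<exists>p. \<forall>(l :: real ^ 'n \<Rightarrow> 'z \<Rightarrow> real) m n z lam \<mu> L.
        fl_problem l m n z lam \<mu> L \<longrightarrow>
        (\<exists>K. admissible_K lam \<mu> L K \<and> K_order A p lam \<mu> L K)) \<and>
     (\<exists>C>0. \<forall>A>0. \<forall>p. \<exists>B>0. \<exists>q.
        \<forall>(l :: real ^ 'n \<Rightarrow> 'z \<Rightarrow> real) m n z lam \<mu> L \<kappa> K wg wl wg_opt wl_opt.
        fl_problem l m n z lam \<mu> L \<and> \<kappa> = L / \<mu> \<and>
        admissible_K lam \<mu> L K \<and> K_order A p lam \<mu> L K \<and>
        fed_gd_run l m n z lam (step_local lam L) (step_global lam L) K wg wl \<and>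
        fl_minimizer l m n z lam wg_opt wl_opt \<longrightarrow>
        converges_linearly wg wg_opt (1 - (lam + L) / (4 * \<kappa> * (lam + \<mu>))) \<and>
        (\<forall>i\<in>{1..m}. converges_linearly (\<lambda>t. wl t 0 i) (wl_opt i)
            (1 - (lam + L) / (4 * \<kappa> * (lam + \<mu>)))) \<and>
        (\<forall>\<^sub>F \<epsilon> in at_right 0. \<exists>N\<ge>1.
            (\<forall>T\<ge>N. eps_solution m wg wl wg_opt wl_opt \<epsilon> T) \<and>
            real N \<le> C * (\<kappa> * ((lam + \<mu>) / (lam + L)) * ln (1 / \<epsilon>)) \<and>
            real (K * N) \<le> B * (1 + ln \<kappa>) ^ q * (\<kappa> * ln (1 / \<epsilon>))))"
proof (intro conjI)
  show "\<exists>A>0. \<exists>p. \<forall>(l :: real ^ 'n \<Rightarrow> 'z \<Rightarrow> real) m n z lam \<mu> L.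
      fl_problem l m n z lam \<mu> L \<longrightarrow> (\<exists>K. admissible_K lam \<mu> L K \<and> K_order A p lam \<mu> L K)"
    by (intro exI[of _ 25] exI[of _ 1] conjI allI impI admissible_K_exists)
      (auto dest: fl_problem_pos)
\<comment> \<open>\<open>C = 9\<close> is fixed before \<open>A\<close> and \<open>p\<close>; the
  gradient count then takes \<open>B = 9 * A\<close> and \<open>q = p\<close>.\<close>
qed (rule exI[of _ 9], intro conjI allI impI, simp, rule_tac x = "9 * A" in exI, intro conjI, simp,
    rule_tac x = p in exI, intro allI impI, elim conjE, rule fed_gd_complexity)

end
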